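(* Let $\psi\in C([-1,1])$ be even. Suppose $\Lambda_\psi$ is finite and put $M_\psi:=\sum_{\ell\in\Lambda_\psi}h_\ell^{(d)}$. Then there exists a measure $\mu=\sum_{j=1}^N w_j\delta_{x_j}$ with $x_j\in\mathbb S^{d-1}$, $w_j>0$, $\sum_{j=1}^N w_j=1$, that is universally exact for $\psi$, i.e. $\int\mathcal B_\psi K\,d\mu=\int\mathcal B_\psi K\,d\sigma$ for every $K\in\mathcal K^d_\circ$, and with $$N\le M_\psi+1.$$
   Context: Fix an integer $d\ge 2$. $\sigma$ is the normalized rotation-invariant Borel probability measure on the unit sphere $\mathbb S^{d-1}\subset\mathbb R^d$. $\mathcal K^d_\circ$ is the set of convex bodies (compact convex sets) in $\mathbb R^d$ with nonempty interior. For $K\in\mathcal K^d_\circ$, the surface area measure $S_K$ on $\mathbb S^{d-1}$ is the pushforward of $(d-1)$-dimensional Hausdorff measure on $\partial K$ under the ($\mathcal H^{d-1}$-a.e. defined) outer Gauss map. For even $\psi\in C([-1,1])$ (real-valued), $$\mathcal B_\psi K(u):=\frac12\int_{\mathbb S^{d-1}}\psi(\langle u,v\rangle)\,dS_K(v),\qquad u\in\mathbb S^{d-1}.$$ $\mathcal H_\ell$ denotes the space of restrictions to $\mathbb S^{d-1}$ of real homogeneous harmonic polynomials of degree $\ell$ on $\mathbb R^d$, and $h_\ell^{(d)}=\dim\mathcal H_\ell=\binom{d+\ell-1}{\ell}-\binom{d+\ell-3}{\ell-2}$ (second binomial zero for $\ell<2$). The Funk--Hecke multiplier $\lambda_\ell(\psi)$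 is the scalar such that $\int_{\mathbb S^{d-1}}\psi(\langle u,v\rangle)Y(v)\,d\sigma(v)=\lambda_\ell(\psi)Y(u)$ for all $Y\in\mathcal H_\ell$, $u\in\mathbb S^{d-1}$. The active spectrum is $\Lambda_\psi:=\{\ell\ge1:\lambda_\ell(\psi)\ne0\}$. *)

theory Defs
  imports "HOL-Analysis.Analysis"
begin

section \<open>Hausdorff measure\<close>

definition hausdorff_premeasure :: "nat \<Rightarrow> real \<Rightarrow> 'a::metric_space set \<Rightarrow> ennreal" where
  "hausdorff_premeasure m \<delta> A =
     (INF U \<in> {U :: nat \<Rightarrow> 'a set. A \<subseteq> (\<Union>i. U i) \<and> (\<forall>i. bounded (U i) \<and> diameter (U i) \<le> \<delta>)}.
        \<Sum>i. if U i = {} then 0 else ennreal (unit_ball_vol (real m) * (diameter (U i) / 2) ^ m))"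

text \<open>
  The factor \<open>unit_ball_vol m / 2 ^ m\<close> in the premeasure is the normalization for which the
  \<open>m\<close>-dimensional Hausdorff measure is Lebesgue measure on \<open>m\<close>-dimensional subspaces. The set
  function below is a metric outer measure, hence countably additive on the Borel sets, so that
  \<open>measure_of\<close> does not fall back to the null measure.
\<close>

definition hausdorff_measure :: "nat \<Rightarrow> 'a::metric_space measure" where
  "hausdorff_measure m =
     measure_of UNIV (sets borel) (\<lambda>A. SUP \<delta>\<in>{0<..}. hausdorff_premeasure m \<delta> A)"


section \<open>Measures on the unit sphere\<close>

abbreviation unit_sphere :: "'a::euclidean_space set" where
  "unit_sphere \<equiv> sphere 0 1"

abbreviation sphere_borel :: "'a::euclidean_space measure" where
  "sphere_borel \<equiv> restrict_space borel unit_sphere"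

text \<open>
  In dimension at least 2, exactly one measure satisfies this predicate; invariance under
  orientation-preserving orthogonal maps only would single out the same measure.
\<close>

definition uniform_on_sphere :: "'a::euclidean_space measure \<Rightarrow> bool" where
  "uniform_on_sphere \<sigma> \<longleftrightarrow>
     sets \<sigma> = sets sphere_borel \<and> emeasure \<sigma> (space \<sigma>) = 1 \<and>
     (\<forall>f. orthogonal_transformation f \<longrightarrow> distr \<sigma> sphere_borel f = \<sigma>)"

text \<open>
  The measure \<open>\<Sum>j=1..N. w j \<delta>\<^bsub>x j\<^esub>\<close>, as the image under \<open>x\<close> of the weighted counting measure on
  the indices; points occurring several times accumulate their weights.
\<close>

definition atomic_measure :: "nat \<Rightarrow> (nat \<Rightarrow> real) \<Rightarrow> (nat \<Rightarrow> 'a::euclidean_space) \<Rightarrow> 'a measure" where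
  "atomic_measure N w x = distr (point_measure {1..N} (\<lambda>j. ennreal (w j))) sphere_borel x"

lemma emeasure_atomic_measure:
  assumes "\<And>j. j \<in> {1..N} \<Longrightarrow> x j \<in> unit_sphere" and "A \<in> sets sphere_borel"
  shows "emeasure (atomic_measure N w x) A = (\<Sum>j=1..N. ennreal (w j) * indicator A (x j))"
proof -
  have m: "x \<in> measurable (point_measure {1..N} (\<lambda>j. ennreal (w j))) sphere_borel"
    using assms(1) by (auto simp: space_restrict_space)
  have "emeasure (atomic_measure N w x) A = (\<Sum>j\<in>x -` A \<inter> {1..N}. ennreal (w j))"
    unfolding atomic_measure_def
    by (subst emeasure_distr[OF m assms(2)]) (simp add: emeasure_point_measure_finite space_point_measure)
  also have "\<dots> = (\<Sum>j=1..N. ennreal (w j) * indicator A (x j))"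
    by (rule sum.mono_neutral_cong_left) (auto simp: indicator_def)
  finally show ?thesis .
qed


section \<open>Convex bodies and surface area measures\<close>

definition convex_bodies :: "'a::euclidean_space set set" where
  "convex_bodies = {K. compact K \<and> convex K \<and> interior K \<noteq> {}}"

definition outer_unit_normals :: "'a::euclidean_space set \<Rightarrow> 'a \<Rightarrow> 'a set" where
  "outer_unit_normals K x = {u \<in> unit_sphere. \<forall>y\<in>K. u \<bullet> y \<le> u \<bullet> x}"

definition regular_boundary :: "'a::euclidean_space set \<Rightarrow> 'a set" where
  "regular_boundary K = {x \<in> frontier K. \<exists>!u. u \<in> outer_unit_normals K x}"

definition gauss_map :: "'a::euclidean_space set \<Rightarrow> 'a \<Rightarrow> 'a" where
  "gauss_map K x = (THE u. u \<in> outer_unit_normals K x)"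

text \<open>
  For a convex body, \<open>regular_boundary K\<close> is a Borel set of full \<open>(d - 1)\<close>-dimensional Hausdorff
  measure in the boundary, and the Gauss map is continuous on it.
\<close>

definition surface_area_measure :: "'a::euclidean_space set \<Rightarrow> 'a measure" where
  "surface_area_measure K =
     distr (restrict_space (hausdorff_measure (DIM('a) - 1)) (regular_boundary K))
       sphere_borel (gauss_map K)"

definition B_transform :: "(real \<Rightarrow> real) \<Rightarrow> 'a::euclidean_space set \<Rightarrow> 'a \<Rightarrow> real" where
  "B_transform \<psi> K u = 1 / 2 * (LINT v|surface_area_measure K. \<psi> (u \<bullet> v))"

definition universally_exact ::
    "'a::euclidean_space measure \<Rightarrow> (real \<Rightarrow> real) \<Rightarrow> 'a measure \<Rightarrow> bool" where
  "universally_exact \<sigma> \<psi> \<mu> \<longleftrightarrow>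
     (\<forall>K\<in>convex_bodies. (LINT u|\<mu>. B_transform \<psi> K u) = (LINT u|\<sigma>. B_transform \<psi> K u))"


section \<open>Spherical harmonics and Funk--Hecke multipliers\<close>

definition laplacian :: "('a::euclidean_space \<Rightarrow> real) \<Rightarrow> 'a \<Rightarrow> real" where
  "laplacian f x = (\<Sum>b\<in>Basis. (deriv ^^ 2) (\<lambda>t. f (x + t *\<^sub>R b)) 0)"

definition homogeneous_harmonic_polys :: "nat \<Rightarrow> ('a::euclidean_space \<Rightarrow> real) set" where
  "homogeneous_harmonic_polys l =
     {p. real_polynomial_function p \<and> (\<forall>c x. p (c *\<^sub>R x) = c ^ l * p x) \<and> (\<forall>x. laplacian p x = 0)}"

definition spherical_harmonics :: "nat \<Rightarrow> ('a::euclidean_space \<Rightarrow> real) set" where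
  "spherical_harmonics l = (\<lambda>p. restrict p unit_sphere) ` homogeneous_harmonic_polys l"

text \<open>The dimension of \<open>spherical_harmonics l\<close> on the sphere in \<open>d\<close>-space, for \<open>d \<ge> 2\<close>.\<close>

definition harmonic_dim :: "nat \<Rightarrow> nat \<Rightarrow> nat" where
  "harmonic_dim d l =
     ((d + l - 1) choose l) - (if l < 2 then 0 else (d + l - 3) choose (l - 2))"

definition funk_hecke_multiplier ::
    "'a::euclidean_space measure \<Rightarrow> (real \<Rightarrow> real) \<Rightarrow> nat \<Rightarrow> real" where
  "funk_hecke_multiplier \<sigma> \<psi> l =
     (THE c. \<forall>Y\<in>spherical_harmonics l. \<forall>u\<in>unit_sphere. (LINT v|\<sigma>. \<psi> (u \<bullet> v) * Y v) = c * Y u)"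

definition active_spectrum :: "'a::euclidean_space measure \<Rightarrow> (real \<Rightarrow> real) \<Rightarrow> nat set" where
  "active_spectrum \<sigma> \<psi> = {l. 1 \<le> l \<and> funk_hecke_multiplier \<sigma> \<psi> l \<noteq> 0}"

end

theory Submission
  imports Defs
begin

text \<open>
  By the Funk--Hecke formula, integration against the kernel \<open>\<psi> (u \<bullet> v)\<close> annihilates all harmonics of
  degree \<open>l \<ge> 1\<close> outside the active spectrum. So if \<open>\<mu>\<close> has the same moments as \<open>\<sigma>\<close> against the harmonics of
  active degree, then \<open>g v = \<integral>\<psi> (u \<bullet> v) d\<mu>(u) - \<integral>\<psi> (u \<bullet> v) d\<sigma>(u)\<close> is orthogonal to every harmonic, hence
  to every polynomial, hence zero; integrating \<open>g\<close> against the (finite) surface area measure of \<open>K\<close> gives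
  exactness. There are \<open>M\<close> such moments, and Tchakaloff's theorem realizes them with \<open>M + 1\<close> atoms.

  The analysis on the sphere rests on a single identity, which follows from infinitesimal rotation
  invariance: for a homogeneous polynomial \<open>p\<close> of degree \<open>n\<close>, \<open>n (n + d - 2) \<integral>p d\<sigma> = \<integral>\<Delta>p d\<sigma>\<close>. Applied to
  \<open>p v = (u \<bullet> v)\<^sup>k Y v\<close> it yields the Funk--Hecke formula for powers by recursion on \<open>k\<close>.
\<close>

section \<open>Directional derivatives of polynomials\<close>

text \<open>All that is known of \<open>\<sigma>\<close> is its invariance, so neither polar
  coordinates nor slicing by parallels is at hand: integrals are computed by differentiating the
  invariance under rotations of coordinate planes. Polynomials are plain functions without
  coefficients; degrees are therefore carried by homogeneity and coefficients by derivatives at the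
  origin. This is how \<open>harmonic_dim\<close> enters: as a count of derivatives that determine a
  harmonic polynomial.

  The \<open>+ 1\<close> pays for the constant function, whose moment makes the weights sum to 1
  and, on the way, keeps approximate weights in a compact interval.

  Two points lie outside harmonic analysis. The difference \<open>g\<close> must vanish at every
  point and not merely almost everywhere, because the surface area measure of a polytope has finite
  support; this is where the full support of \<open>\<sigma>\<close> comes in. And interchanging
  integrals requires \<open>surface_area_measure K\<close> to be finite, which is read off from
  explicit coverings of the boundary of \<open>K\<close>.\<close>

definition dir_deriv :: "'a::euclidean_space \<Rightarrow> ('a \<Rightarrow> real) \<Rightarrow> 'a \<Rightarrow> real" where
  "dir_deriv u p x = deriv (\<lambda>t. p (x + t *\<^sub>R u)) 0"

definition homogeneous :: "nat \<Rightarrow> ('a::euclidean_space \<Rightarrow> real) \<Rightarrow> bool" where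
  "homogeneous n p \<longleftrightarrow> (\<forall>c x. p (c *\<^sub>R x) = c ^ n * p x)"

text \<open>Built by iterating \<open>dir_deriv\<close>, so that the product and commutation rules
  apply term by term; \<open>laplacian\<close> differentiates twice along one line instead, and the
  two agree on polynomials.\<close>

definition lap :: "('a::euclidean_space \<Rightarrow> real) \<Rightarrow> 'a \<Rightarrow> real" where
  "lap p = (\<lambda>x. \<Sum>b\<in>Basis. dir_deriv b (dir_deriv b p) x)"

lemma dir_deriv_eq:
  assumes "(p has_derivative D) (at x)"
  shows "dir_deriv u p x = D u"
proof -
  have "((\<lambda>t. p (x + t *\<^sub>R u)) has_derivative (\<lambda>t. D (t *\<^sub>R u))) (at 0)"
    by (rule has_derivative_compose[of "\<lambda>t. x + t *\<^sub>R u" _ 0 UNIV p, simplified])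
      (use assms in \<open>auto intro!: derivative_eq_intros\<close>)
  moreover have "D (t *\<^sub>R u) = D u * t" for t
    using has_derivative_linear[OF assms] by (simp add: linear_cmul)
  ultimately have "((\<lambda>t. p (x + t *\<^sub>R u)) has_field_derivative D u) (at 0)"
    by (simp add: has_field_derivative_def)
  then show ?thesis
    unfolding dir_deriv_def by (rule DERIV_imp_deriv)
qed

lemma has_derivative_dir_deriv:
  assumes "real_polynomial_function p"
  shows "(p has_derivative (\<lambda>u. dir_deriv u p x)) (at x)"
proof -
  have "\<exists>D. (p has_derivative D) (at x)"
    using assms
  proof induction
    case (linear f)
    then show ?case using bounded_linear_imp_has_derivative by blast
  next
    case (const c)
    then show ?case by (auto intro: derivative_intros)
  next
    case (add f g)
    then show ?case by (auto intro: has_derivative_add)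
  next
    case (mult f g)
    then show ?case by (auto intro: has_derivative_mult)
  qed
  then obtain D where D: "(p has_derivative D) (at x)" ..
  then have "(\<lambda>u. dir_deriv u p x) = D"
    by (simp add: dir_deriv_eq fun_eq_iff)
  with D show ?thesis by simp
qed

lemma linear_dir_deriv:
  "real_polynomial_function p \<Longrightarrow> linear (\<lambda>u. dir_deriv u p x)"
  using has_derivative_dir_deriv has_derivative_linear by blast

lemma dir_deriv_scaleR:
  "real_polynomial_function p \<Longrightarrow> dir_deriv (c *\<^sub>R u) p x = c * dir_deriv u p x"
  using linear_cmul[OF linear_dir_deriv] by fastforce

lemma dir_deriv_linear: "bounded_linear f \<Longrightarrow> dir_deriv u f = (\<lambda>x. f u)"
  by (rule ext, rule dir_deriv_eq) (rule bounded_linear_imp_has_derivative)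

lemma dir_deriv_const [simp]: "dir_deriv u (\<lambda>x. c) = (\<lambda>x. 0)"
  by (rule ext) (simp add: dir_deriv_def)

lemma dir_deriv_add:
  assumes "real_polynomial_function p" "real_polynomial_function q"
  shows "dir_deriv u (\<lambda>x. p x + q x) = (\<lambda>x. dir_deriv u p x + dir_deriv u q x)"
proof
  fix x
  show "dir_deriv u (\<lambda>x. p x + q x) x = dir_deriv u p x + dir_deriv u q x"
    using dir_deriv_eq[OF has_derivative_add[OF assms[THEN has_derivative_dir_deriv]]] by simp
qed

lemma dir_deriv_mult:
  assumes "real_polynomial_function p" "real_polynomial_function q"
  shows "dir_deriv u (\<lambda>x. p x * q x) = (\<lambda>x. p x * dir_deriv u q x + dir_deriv u p x * q x)"
proof
  fix x
  show "dir_deriv u (\<lambda>x. p x * q x) x = p x * dir_deriv u q x + dir_deriv u p x * q x"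
    using dir_deriv_eq[OF has_derivative_mult[OF assms[THEN has_derivative_dir_deriv]]] by simp
qed

lemma dir_deriv_cmult:
  "real_polynomial_function p \<Longrightarrow> dir_deriv u (\<lambda>x. c * p x) = (\<lambda>x. c * dir_deriv u p x)"
  using dir_deriv_mult[OF real_polynomial_function.intros(2)] by fastforce

lemma dir_deriv_sum:
  "finite I \<Longrightarrow> (\<And>i. i \<in> I \<Longrightarrow> real_polynomial_function (p i)) \<Longrightarrow>
    dir_deriv u (\<lambda>x. \<Sum>i\<in>I. p i x) = (\<lambda>x. \<Sum>i\<in>I. dir_deriv u (p i) x)"
proof (induction rule: finite_induct)
  case (insert i I)
  then have "real_polynomial_function (\<lambda>x. \<Sum>i\<in>I. p i x)"
    by (intro real_polynomial_function_sum) auto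
  with insert show ?case by (simp add: dir_deriv_add)
qed simp

lemma real_polynomial_function_dir_deriv [intro]:
  "real_polynomial_function p \<Longrightarrow> real_polynomial_function (dir_deriv u p)"
proof (induction rule: real_polynomial_function.induct)
  case (linear f)
  then show ?case by (auto simp: dir_deriv_linear)
qed (auto simp: dir_deriv_add dir_deriv_mult)

lemma real_polynomial_function_lap [intro]:
  "real_polynomial_function p \<Longrightarrow> real_polynomial_function (lap p)"
  unfolding lap_def by (intro real_polynomial_function_sum) auto

text \<open>Symmetry of second derivatives comes from the inductive structure: linear maps have
  constant first derivatives, and the product rule applied twice is symmetric in \<open>u\<close>
  and \<open>v\<close> once this holds for the factors.\<close>

lemma dir_deriv_commute:
  "real_polynomial_function p \<Longrightarrow> dir_deriv u (dir_deriv v p) = dir_deriv v (dir_deriv u p)"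
proof (induction rule: real_polynomial_function.induct)
  case (linear f)
  then show ?case by (simp add: dir_deriv_linear)
next
  case (mult f g)
  then show ?case
    by (simp add: dir_deriv_mult dir_deriv_add real_polynomial_function.intros(4)
        real_polynomial_function_dir_deriv algebra_simps)
qed (auto simp: dir_deriv_add real_polynomial_function_dir_deriv)

lemma has_real_derivative_line:
  assumes "real_polynomial_function p"
  shows "((\<lambda>t. p (x + t *\<^sub>R u)) has_real_derivative dir_deriv u p (x + s *\<^sub>R u)) (at s)"
proof -
  have "((\<lambda>t. p (x + t *\<^sub>R u)) has_derivative (\<lambda>t. dir_deriv (t *\<^sub>R u) p (x + s *\<^sub>R u))) (at s)"
    by (rule has_derivative_compose[of "\<lambda>t. x + t *\<^sub>R u" _ s UNIV p, simplified])
      (use assms has_derivative_dir_deriv in \<open>auto intro!: derivative_eq_intros\<close>)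
  moreover have "dir_deriv (t *\<^sub>R u) p y = dir_deriv u p y * t" for t y
    using assms by (simp add: dir_deriv_scaleR)
  ultimately show ?thesis
    by (simp add: has_field_derivative_def)
qed

lemma laplacian_eq_lap:
  assumes "real_polynomial_function p"
  shows "laplacian p = lap p"
proof
  fix x
  have "deriv (\<lambda>t. p (x + t *\<^sub>R b)) = (\<lambda>s. dir_deriv b p (x + s *\<^sub>R b))" for b
    using has_real_derivative_line[OF assms] DERIV_imp_deriv by blast
  then show "laplacian p x = lap p x"
    by (simp add: laplacian_def lap_def numeral_2_eq_2 dir_deriv_def)
qed

lemma dir_deriv_inner [simp]: "dir_deriv u (\<lambda>x. a \<bullet> x) = (\<lambda>x. a \<bullet> u)"
  by (simp add: dir_deriv_linear bounded_linear_inner_right)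

lemma dir_deriv_inner' [simp]: "dir_deriv u (\<lambda>x. x \<bullet> a) = (\<lambda>x. u \<bullet> a)"
  by (simp add: dir_deriv_linear bounded_linear_inner_left)

lemma real_polynomial_function_inner [intro]:
  "real_polynomial_function (\<lambda>x. a \<bullet> x)" "real_polynomial_function (\<lambda>x. x \<bullet> a)"
  by (auto intro: bounded_linear_inner_left bounded_linear_inner_right)

lemma inner_self_eq_sum: "x \<bullet> x = (\<Sum>b\<in>Basis. (x \<bullet> b) * (x \<bullet> b))" for x :: "'a::euclidean_space"
  by (rule euclidean_inner)

lemma real_polynomial_function_inner_self [intro]:
  "real_polynomial_function (\<lambda>x::'a::euclidean_space. x \<bullet> x)"
  unfolding inner_self_eq_sum by (intro real_polynomial_function_sum) auto

lemma dir_deriv_inner_self [simp]: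
  "dir_deriv u (\<lambda>x. x \<bullet> x) = (\<lambda>x. 2 * (x \<bullet> u))" for u :: "'a::euclidean_space"
proof
  fix x :: 'a
  have "((\<lambda>x::'a. x \<bullet> x) has_derivative (\<lambda>v. x \<bullet> v + v \<bullet> x)) (at x)"
    by (auto intro!: derivative_eq_intros)
  from dir_deriv_eq[OF this] show "dir_deriv u (\<lambda>x. x \<bullet> x) x = 2 * (x \<bullet> u)"
    by (simp add: inner_commute)
qed

text \<open>Differentiating \<open>p (c *\<^sub>R x) = c ^ n * p x\<close> in \<open>x\<close>
  yields the claim multiplied by \<open>c\<close>, which settles \<open>c \<noteq> 0\<close>; the
  value at \<open>c = 0\<close> follows by continuity. For \<open>n = 0\<close> the truncated degree
  \<open>n - 1\<close> is harmless: \<open>p\<close> is constant and its derivative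
  vanishes.\<close>

lemma homogeneous_dir_deriv:
  assumes p: "real_polynomial_function p" and h: "homogeneous n p"
  shows "homogeneous (n - 1) (dir_deriv u p)"
proof (cases n)
  case 0
  have "p x = p 0" for x
    using h[unfolded homogeneous_def, rule_format, of 0 x] 0 by simp
  then have "p = (\<lambda>x. p 0)" by blast
  then have "dir_deriv u p = (\<lambda>x. 0)"
    by (metis dir_deriv_const)
  then show ?thesis by (simp add: homogeneous_def)
next
  case (Suc m)
  have ne: "dir_deriv u p (c *\<^sub>R x) = c ^ m * dir_deriv u p x" if "c \<noteq> 0" for c x
  proof -
    have "((\<lambda>x. p (c *\<^sub>R x)) has_derivative (\<lambda>v. dir_deriv (c *\<^sub>R v) p (c *\<^sub>R x))) (at x)"
      by (rule has_derivative_compose[of "\<lambda>x. c *\<^sub>R x" _ x UNIV p, simplified])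
        (use p has_derivative_dir_deriv in \<open>auto intro!: derivative_eq_intros\<close>)
    from dir_deriv_eq[OF this]
    have "dir_deriv u (\<lambda>x. p (c *\<^sub>R x)) x = c * dir_deriv u p (c *\<^sub>R x)"
      using p by (simp add: dir_deriv_scaleR)
    moreover have "(\<lambda>x. p (c *\<^sub>R x)) = (\<lambda>x. c ^ n * p x)"
      using h by (simp add: homogeneous_def)
    ultimately have "c * dir_deriv u p (c *\<^sub>R x) = c ^ n * dir_deriv u p x"
      using p by (simp add: dir_deriv_cmult)
    with that Suc show ?thesis by simp
  qed
  have "dir_deriv u p (c *\<^sub>R x) = c ^ m * dir_deriv u p x" for c x
  proof (cases "c = 0")
    case True
    have cont: "continuous_on UNIV (dir_deriv u p)"
      using p continuous_on_polymonial_function real_polynomial_function_eq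
        real_polynomial_function_dir_deriv by blast
    then have "((\<lambda>c. dir_deriv u p (c *\<^sub>R x)) \<longlongrightarrow> dir_deriv u p (0 *\<^sub>R x)) (at (0::real))"
      by (intro isCont_tendsto_compose[of _ "dir_deriv u p"] tendsto_intros)
        (auto simp: continuous_on_eq_continuous_at)
    moreover have "((\<lambda>c. c ^ m * dir_deriv u p x) \<longlongrightarrow> 0 ^ m * dir_deriv u p x) (at (0::real))"
      by (intro tendsto_intros)
    then have "((\<lambda>c. dir_deriv u p (c *\<^sub>R x)) \<longlongrightarrow> 0 ^ m * dir_deriv u p x) (at (0::real))"
      by (rule Lim_transform_eventually) (auto simp: eventually_at_filter ne)
    ultimately show ?thesis
      using True tendsto_unique[OF trivial_limit_at] by blast
  qed (rule ne)
  with Suc show ?thesis by (simp add: homogeneous_def)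
qed

lemma euler_homogeneous:
  assumes p: "real_polynomial_function p" and h: "homogeneous n p"
  shows "dir_deriv x p x = n * p x"
proof -
  have "p (x + t *\<^sub>R x) = (1 + t) ^ n * p x" for t
    using h[unfolded homogeneous_def, rule_format, of "1 + t" x] by (simp add: scaleR_add_left)
  moreover have "((\<lambda>t. (1 + t) ^ n * p x) has_real_derivative n * p x) (at 0)"
    by (auto intro!: derivative_eq_intros)
  ultimately show ?thesis
    unfolding dir_deriv_def by (simp add: DERIV_imp_deriv)
qed

lemma sum_inner_dir_deriv:
  assumes p: "real_polynomial_function p"
  shows "(\<Sum>b\<in>Basis. (y \<bullet> b) * dir_deriv b p x) = dir_deriv y p x"
proof -
  have "dir_deriv y p x = dir_deriv (\<Sum>b\<in>Basis. (y \<bullet> b) *\<^sub>R b) p x"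
    by (simp add: euclidean_representation)
  also have "\<dots> = (\<Sum>b\<in>Basis. (y \<bullet> b) * dir_deriv b p x)"
    by (simp add: linear_sum[OF linear_dir_deriv[OF p]] dir_deriv_scaleR p
        del: euclidean_representation)
  finally show ?thesis by simp
qed

section \<open>Calculus of the Laplacian\<close>

lemma lap_add:
  "real_polynomial_function p \<Longrightarrow> real_polynomial_function q \<Longrightarrow>
    lap (\<lambda>x. p x + q x) = (\<lambda>x. lap p x + lap q x)"
  by (simp add: lap_def dir_deriv_add real_polynomial_function_dir_deriv sum.distrib)

lemma lap_cmult:
  "real_polynomial_function p \<Longrightarrow> lap (\<lambda>x. c * p x) = (\<lambda>x. c * lap p x)"
  by (simp add: lap_def dir_deriv_cmult real_polynomial_function_dir_deriv sum_distrib_left)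

lemma lap_zero [simp]: "lap (\<lambda>x. 0) = (\<lambda>x. 0)"
  by (simp add: lap_def)

lemma lap_mult:
  assumes "real_polynomial_function p" "real_polynomial_function q"
  shows "lap (\<lambda>x. p x * q x) =
    (\<lambda>x. p x * lap q x + 2 * (\<Sum>b\<in>Basis. dir_deriv b p x * dir_deriv b q x) + lap p x * q x)"
  using assms
  by (simp add: lap_def dir_deriv_mult dir_deriv_add real_polynomial_function_dir_deriv
      real_polynomial_function.intros(4) sum.distrib sum_distrib_left sum_distrib_right algebra_simps)

lemma lap_dir_deriv:
  assumes "real_polynomial_function p"
  shows "lap (dir_deriv u p) = dir_deriv u (lap p)"
  unfolding lap_def using assms
  by (simp add: dir_deriv_sum real_polynomial_function_dir_deriv
      dir_deriv_commute[of p _ u] dir_deriv_commute[of "dir_deriv _ p" _ u])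

lemma homogeneous_lap:
  assumes p: "real_polynomial_function p" and h: "homogeneous n p"
  shows "homogeneous (n - 2) (lap p)"
proof -
  have "homogeneous (n - 1 - 1) (dir_deriv b (dir_deriv b p))" for b
    using p h by (intro homogeneous_dir_deriv) auto
  then show ?thesis
    by (simp add: homogeneous_def lap_def sum_distrib_left numeral_2_eq_2)
qed

lemma homogeneous_0D: "homogeneous 0 p \<Longrightarrow> p x = p 0"
  unfolding homogeneous_def by (metis mult_1 power_0 scale_zero_left)

lemma dir_deriv_homogeneous_0: "homogeneous 0 p \<Longrightarrow> dir_deriv u p = (\<lambda>x. 0)"
  by (metis dir_deriv_const ext homogeneous_0D)

text \<open>Below degree 2 the truncated degree in \<open>homogeneous_lap\<close> says too little;
  the vanishing stated here is what makes iterated Laplacians of a polynomial terminate.\<close>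

lemma lap_homogeneous_less_2:
  assumes p: "real_polynomial_function p" and h: "homogeneous n p" and n: "n < 2"
  shows "lap p = (\<lambda>x. 0)"
proof -
  have "homogeneous 0 (dir_deriv b p)" for b
    using homogeneous_dir_deriv[OF p h, of b] n by (simp add: numeral_2_eq_2 less_Suc_eq_le)
  then show ?thesis
    by (simp add: lap_def dir_deriv_homogeneous_0)
qed

lemma homogeneous_mult:
  "homogeneous m p \<Longrightarrow> homogeneous n q \<Longrightarrow> homogeneous (m + n) (\<lambda>x. p x * q x)"
  by (simp add: homogeneous_def power_add)

lemma homogeneous_inner: "homogeneous 1 (\<lambda>x. a \<bullet> x)"
  by (simp add: homogeneous_def)

lemma homogeneous_inner_self: "homogeneous 2 (\<lambda>x. x \<bullet> x)"
  by (simp add: homogeneous_def power2_eq_square)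

lemma homogeneous_power: "homogeneous m p \<Longrightarrow> homogeneous (m * n) (\<lambda>x. p x ^ n)"
  by (simp add: homogeneous_def power_mult power_mult_distrib)

lemma homogeneous_harmonic_polys_iff:
  "p \<in> homogeneous_harmonic_polys l \<longleftrightarrow>
    real_polynomial_function p \<and> homogeneous l p \<and> lap p = (\<lambda>x. 0)"
  unfolding homogeneous_harmonic_polys_def homogeneous_def
  by (auto simp: laplacian_eq_lap fun_eq_iff)

section \<open>Integration over the sphere\<close>

lemma real_polynomial_function_continuous_on:
  "real_polynomial_function p \<Longrightarrow> continuous_on S p"
  using continuous_on_polymonial_function real_polynomial_function_eq by blast

lemma bounded_on_sphere:
  assumes "continuous_on unit_sphere (f :: 'a::euclidean_space \<Rightarrow> real)"
  obtains C where "0 \<le> C" "\<And>x. x \<in> unit_sphere \<Longrightarrow> \<bar>f x\<bar> \<le> C"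
proof -
  have "bounded (f ` unit_sphere)"
    using assms compact_continuous_image compact_imp_bounded compact_sphere by blast
  then obtain C where "\<And>x. x \<in> unit_sphere \<Longrightarrow> norm (f x) \<le> C"
    unfolding bounded_iff by blast
  then have "\<And>x. x \<in> unit_sphere \<Longrightarrow> \<bar>f x\<bar> \<le> max C 0"
    by (smt (verit) real_norm_def)
  then show thesis
    using that[of "max C 0"] by simp
qed

lemma borel_measurable_sphere:
  assumes "sets M = sets sphere_borel" "continuous_on unit_sphere (f :: 'a::euclidean_space \<Rightarrow> real)"
  shows "f \<in> borel_measurable M"
  using borel_measurable_continuous_on_restrict[OF assms(2)] measurable_cong_sets[OF assms(1) refl]
  by blast

lemma integrable_continuous_sphere:
  assumes "finite_measure M" "sets M = sets sphere_borel"
    and "continuous_on unit_sphere (f :: 'a::euclidean_space \<Rightarrow> real)"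
  shows "integrable M f"
proof -
  obtain C where C: "\<And>x. x \<in> unit_sphere \<Longrightarrow> \<bar>f x\<bar> \<le> C"
    using bounded_on_sphere[OF assms(3)] by blast
  have "space M = unit_sphere"
    using sets_eq_imp_space_eq[OF assms(2)] by (simp add: space_restrict_space)
  with C have "AE x in M. norm (f x) \<le> C"
    by (intro AE_I2) simp
  then show ?thesis
    by (rule finite_measure.integrable_const_bound[OF assms(1) _ borel_measurable_sphere[OF assms(2,3)]])
qed

locale uniform_sphere =
  fixes \<sigma> :: "'a::euclidean_space measure"
  assumes uniform: "uniform_on_sphere \<sigma>" and dim: "2 \<le> DIM('a)"
begin

lemma sets_eq: "sets \<sigma> = sets sphere_borel"
  using uniform by (simp add: uniform_on_sphere_def)

lemma space_eq: "space \<sigma> = unit_sphere"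
  using sets_eq_imp_space_eq[OF sets_eq] by (simp add: space_restrict_space)

sublocale finite_measure \<sigma>
  by standard (use uniform in \<open>simp add: uniform_on_sphere_def\<close>)

lemma measure_space_eq_1 [simp]: "measure \<sigma> (space \<sigma>) = 1"
  using uniform by (simp add: uniform_on_sphere_def measure_def)

lemma integrable_continuous: "continuous_on unit_sphere f \<Longrightarrow> integrable \<sigma> f" for f :: "'a \<Rightarrow> real"
  using integrable_continuous_sphere[OF finite_measure_axioms sets_eq] .

lemma integrable_poly: "real_polynomial_function p \<Longrightarrow> integrable \<sigma> p"
  by (intro integrable_continuous real_polynomial_function_continuous_on)

lemma integral_sphere_cong:
  "(\<And>x. x \<in> unit_sphere \<Longrightarrow> f x = g x) \<Longrightarrow> (LINT x|\<sigma>. f x) = (LINT x|\<sigma>. g x)"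
  by (intro Bochner_Integration.integral_cong) (auto simp: space_eq)

lemma measurable_orthogonal:
  assumes "orthogonal_transformation f"
  shows "f \<in> measurable \<sigma> sphere_borel"
proof -
  have "continuous_on unit_sphere f"
    using assms linear_continuous_on linear_conv_bounded_linear orthogonal_transformation_linear by blast
  then have "f \<in> measurable sphere_borel borel"
    by (rule borel_measurable_continuous_on_restrict)
  moreover have "f ` unit_sphere \<subseteq> unit_sphere"
    using assms by (auto simp: orthogonal_transformation_norm)
  ultimately have "f \<in> measurable sphere_borel sphere_borel"
    by (intro measurable_restrict_space2) (auto simp: space_restrict_space)
  then show ?thesis
    using measurable_cong_sets[OF sets_eq refl] by blast
qed

lemma integral_orthogonal:
  assumes "orthogonal_transformation f" and "continuous_on unit_sphere (g :: 'a \<Rightarrow> real)"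
  shows "(LINT x|\<sigma>. g (f x)) = (LINT x|\<sigma>. g x)"
proof -
  have "distr \<sigma> sphere_borel f = \<sigma>"
    using uniform assms(1) by (simp add: uniform_on_sphere_def)
  then have "(LINT x|\<sigma>. g x) = (LINT x|distr \<sigma> sphere_borel f. g x)"
    by simp
  also have "\<dots> = (LINT x|\<sigma>. g (f x))"
    by (intro integral_distr measurable_orthogonal assms borel_measurable_continuous_on_restrict)
  finally show ?thesis ..
qed

end

section \<open>Rotations in coordinate planes and their generators\<close>

definition plane_rotation :: "'a::euclidean_space \<Rightarrow> 'a \<Rightarrow> real \<Rightarrow> 'a \<Rightarrow> 'a" where
  "plane_rotation b c t v = v + (cos t - 1) *\<^sub>R ((v \<bullet> b) *\<^sub>R b + (v \<bullet> c) *\<^sub>R c)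
     + sin t *\<^sub>R ((v \<bullet> b) *\<^sub>R c - (v \<bullet> c) *\<^sub>R b)"

lemma orthogonal_transformation_plane_rotation:
  assumes "b \<in> Basis" "c \<in> Basis" "b \<noteq> c"
  shows "orthogonal_transformation (plane_rotation b c t)"
  unfolding orthogonal_transformation_def
proof (intro conjI allI)
  show "linear (plane_rotation b c t)"
    by (rule linearI) (simp_all add: plane_rotation_def algebra_simps)
  fix v w :: 'a
  have bc: "b \<bullet> b = 1" "c \<bullet> c = 1" "b \<bullet> c = 0" "c \<bullet> b = 0"
    using assms by (simp_all add: inner_Basis)
  define x y x' y' C S where "x = v \<bullet> b" "y = v \<bullet> c" "x' = w \<bullet> b" "y' = w \<bullet> c" "C = cos t" "S = sin t"
  note d = this
  have "plane_rotation b c t v \<bullet> plane_rotation b c t w - v \<bullet> w = (C^2 + S^2 - 1) * (x * x' + y * y')"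
    unfolding plane_rotation_def
    by (simp add: inner_add inner_diff bc d[symmetric] inner_commute[of b w] inner_commute[of c w]
        power2_eq_square) (simp add: algebra_simps)
  also have "C^2 + S^2 - 1 = 0"
    by (simp add: d)
  finally show "plane_rotation b c t v \<bullet> plane_rotation b c t w = v \<bullet> w"
    by simp
qed

text \<open>The angular momentum operator of the plane of \<open>b\<close> and \<open>c\<close>,
  that is, the infinitesimal generator of \<open>plane_rotation b c\<close>.\<close>

definition rot_deriv :: "'a::euclidean_space \<Rightarrow> 'a \<Rightarrow> ('a \<Rightarrow> real) \<Rightarrow> 'a \<Rightarrow> real" where
  "rot_deriv b c p x = (x \<bullet> b) * dir_deriv c p x - (x \<bullet> c) * dir_deriv b p x"

lemma has_derivative_plane_rotation:
  assumes bc: "b \<in> Basis" "c \<in> Basis" "b \<noteq> c" and p: "real_polynomial_function p"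
  shows "((\<lambda>t. p (plane_rotation b c t v)) has_real_derivative
    rot_deriv b c p (plane_rotation b c t v)) (at t)"
proof -
  \<comment> \<open>\<open>J\<close> is the velocity of the orbit of \<open>v\<close>. Rewritten in
    terms of the point reached, it is the quarter turn of that point's component in the plane, so
    the derivative depends on \<open>t\<close> only through the point.\<close>
  define J where "J t = (- sin t) *\<^sub>R ((v \<bullet> b) *\<^sub>R b + (v \<bullet> c) *\<^sub>R c)
     + cos t *\<^sub>R ((v \<bullet> b) *\<^sub>R c - (v \<bullet> c) *\<^sub>R b)" for t
  let ?R = "plane_rotation b c t v"
  have R: "(plane_rotation b c s v \<bullet> b) = cos s * (v \<bullet> b) - sin s * (v \<bullet> c)"
    "(plane_rotation b c s v \<bullet> c) = cos s * (v \<bullet> c) + sin s * (v \<bullet> b)" for s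
    using bc by (simp_all add: plane_rotation_def inner_add inner_diff inner_Basis algebra_simps)
  have J: "J t = (?R \<bullet> b) *\<^sub>R c - (?R \<bullet> c) *\<^sub>R b"
    unfolding J_def R by (simp add: algebra_simps)
  have "((\<lambda>t. plane_rotation b c t v) has_derivative (\<lambda>s. s *\<^sub>R J t)) (at t)"
    unfolding plane_rotation_def J_def
    by (auto intro!: derivative_eq_intros simp: algebra_simps)
  then have "((\<lambda>t. p (plane_rotation b c t v)) has_derivative (\<lambda>s. dir_deriv (s *\<^sub>R J t) p ?R)) (at t)"
    by (rule has_derivative_compose[OF _ has_derivative_dir_deriv[OF p]])
  moreover have "dir_deriv (J t) p ?R = rot_deriv b c p ?R"
    unfolding J rot_deriv_def
    by (simp add: linear_diff[OF linear_dir_deriv[OF p]] dir_deriv_scaleR[OF p])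
  ultimately show ?thesis
    using p by (auto intro: has_derivative_imp_has_field_derivative simp: dir_deriv_scaleR)
qed

context uniform_sphere
begin

text \<open>The integral of \<open>p\<close> over rotated points is constant in the angle, so its
  derivative at 0 is 0. Differentiation under the integral is dominated convergence along the angles
  \<open>1 / Suc n\<close>: by the mean value theorem each difference quotient is a value of
  \<open>rot_deriv b c p\<close> at another point of the sphere, hence bounded by
  \<open>C\<close>.\<close>

lemma integral_rot_deriv:
  assumes bc: "b \<in> Basis" "c \<in> Basis" and p: "real_polynomial_function p"
  shows "(LINT x|\<sigma>. rot_deriv b c p x) = 0"
proof (cases "b = c")
  case True
  then show ?thesis by (simp add: rot_deriv_def)
next
  case False
  let ?R = "plane_rotation b c" and ?L = "rot_deriv b c p"
  have orth: "orthogonal_transformation (?R t)" for t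
    using orthogonal_transformation_plane_rotation bc False by blast
  have pL: "real_polynomial_function ?L"
    unfolding rot_deriv_def using p by (intro real_polynomial_function_diff real_polynomial_function.intros(4)) auto
  obtain C where C: "\<And>x. x \<in> unit_sphere \<Longrightarrow> \<bar>?L x\<bar> \<le> C"
    using bounded_on_sphere real_polynomial_function_continuous_on[OF pL] by blast
  have der: "((\<lambda>t. p (?R t v)) has_real_derivative ?L (?R t v)) (at t)" for t v
    using has_derivative_plane_rotation bc False p by blast
  have R0: "?R 0 v = v" for v
    by (simp add: plane_rotation_def)
  define s where "s n v = (p (?R (1 / real (Suc n)) v) - p v) / (1 / real (Suc n))" for n v
  have cR: "continuous_on unit_sphere (\<lambda>v. p (?R t v))" for t
  proof (rule continuous_on_compose2[OF real_polynomial_function_continuous_on[OF p, of UNIV]])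
    show "continuous_on unit_sphere (?R t)"
      using orth orthogonal_transformation_linear linear_continuous_on linear_conv_bounded_linear by blast
  qed simp
  have int: "integrable \<sigma> (\<lambda>v. p (?R t v))" for t
    by (rule integrable_continuous[OF cR])
  have s0: "(LINT v|\<sigma>. s n v) = 0" for n
    unfolding s_def
    using integral_orthogonal[OF orth real_polynomial_function_continuous_on[OF p]] int integrable_poly[OF p]
    by simp
  have "(\<lambda>n. LINT v|\<sigma>. s n v) \<longlonglongrightarrow> (LINT v|\<sigma>. ?L v)"
  proof (rule integral_dominated_convergence[where w = "\<lambda>_. C"])
    show "?L \<in> borel_measurable \<sigma>" "\<And>n. s n \<in> borel_measurable \<sigma>"
      unfolding s_def using int integrable_poly[OF p] integrable_poly[OF pL] by auto
    show "AE v in \<sigma>. (\<lambda>n. s n v) \<longlonglongrightarrow> ?L v"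
    proof (rule AE_I2)
      fix v
      have "((\<lambda>h. (p (?R h v) - p v) / h) \<longlongrightarrow> ?L v) (at 0)"
        using der[of v 0] by (simp add: DERIV_def R0)
      moreover have "filterlim (\<lambda>n. 1 / real (Suc n)) (at 0) sequentially"
        unfolding filterlim_at using LIMSEQ_inverse_real_of_nat by (auto simp: inverse_eq_divide)
      ultimately show "(\<lambda>n. s n v) \<longlonglongrightarrow> ?L v"
        unfolding s_def by (rule filterlim_compose)
    qed
    show "AE v in \<sigma>. norm (s n v) \<le> C" for n
    proof (rule AE_I2)
      fix v assume "v \<in> space \<sigma>"
      then have v: "?R t v \<in> unit_sphere" for t
        using orth by (simp add: space_eq orthogonal_transformation_norm)
      let ?h = "1 / real (Suc n)"
      obtain z where "p (?R ?h v) - p (?R 0 v) = (?h - 0) * ?L (?R z v)"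
        using MVT2[of 0 ?h "\<lambda>t. p (?R t v)" "\<lambda>t. ?L (?R t v)"] der by auto
      then have "s n v = ?L (?R z v)"
        by (simp add: s_def R0)
      with C[OF v] show "norm (s n v) \<le> C" by simp
    qed
  qed simp
  with s0 show ?thesis
    using LIMSEQ_unique[OF _ tendsto_const[of 0]] by simp
qed

text \<open>The sum of \<open>rot_deriv b c ((x \<bullet> b) * dir_deriv c p)\<close> over all
  \<open>b\<close> and \<open>c\<close> is half the sum of the squares of all angular momentum
  operators applied to \<open>p\<close>, that is, the spherical Laplacian
  \<open>(x \<bullet> x) * lap p - n * (n + d - 2) * p\<close>. Each summand has the form
  \<open>rot_deriv b c q\<close> and integrates to 0; on the sphere
  \<open>x \<bullet> x = 1\<close>.\<close>

lemma integral_homogeneous: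
  assumes p: "real_polynomial_function p" and h: "homogeneous n p"
  shows "n * (n + real DIM('a) - 2) * (LINT x|\<sigma>. p x) = (LINT x|\<sigma>. lap p x)"
proof -
  let ?q = "\<lambda>b c x. (x \<bullet> b) * dir_deriv c p x"
  have q: "real_polynomial_function (?q b c)" for b c
    using p by (intro real_polynomial_function.intros(4)) auto
  have D: "dir_deriv u (?q b c) = (\<lambda>x. (x \<bullet> b) * dir_deriv u (dir_deriv c p) x + (u \<bullet> b) * dir_deriv c p x)"
    for u b c
    using p by (subst dir_deriv_mult) auto
  have key: "(\<Sum>b\<in>Basis. \<Sum>c\<in>Basis. rot_deriv b c (?q b c) x)
      = (x \<bullet> x) * lap p x - n * (n + real DIM('a) - 2) * p x" for x
  proof -
    \<comment> \<open>The diagonal term comes from differentiating the factor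
      \<open>x \<bullet> b\<close> along \<open>c\<close>. It contributes \<open>n * p x\<close> in
      total, against \<open>n * (n - 1) * p x\<close> from the mixed derivatives and
      \<open>d * n * p x\<close> from the last term.\<close>
    have "rot_deriv b c (?q b c) x = (x \<bullet> b) * (x \<bullet> b) * dir_deriv c (dir_deriv c p) x
       + (if c = b then (x \<bullet> b) * dir_deriv b p x else 0)
       - (x \<bullet> b) * ((x \<bullet> c) * dir_deriv b (dir_deriv c p) x) - (x \<bullet> c) * dir_deriv c p x"
      if "b \<in> Basis" "c \<in> Basis" for b c
      using that by (auto simp: rot_deriv_def D inner_Basis algebra_simps)
    then have "(\<Sum>b\<in>Basis. \<Sum>c\<in>Basis. rot_deriv b c (?q b c) x) =
        (\<Sum>b\<in>Basis. \<Sum>c\<in>Basis. (x \<bullet> b) * (x \<bullet> b) * dir_deriv c (dir_deriv c p) x)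
        + (\<Sum>b\<in>Basis. (x \<bullet> b) * dir_deriv b p x)
        - (\<Sum>b\<in>Basis. \<Sum>c\<in>Basis. (x \<bullet> b) * ((x \<bullet> c) * dir_deriv b (dir_deriv c p) x))
        - (\<Sum>b\<in>(Basis::'a set). \<Sum>c\<in>Basis. (x \<bullet> c) * dir_deriv c p x)"
      by (simp add: sum.distrib sum_subtractf)
    moreover have "(\<Sum>b\<in>Basis. \<Sum>c\<in>Basis. (x \<bullet> b) * (x \<bullet> b) * dir_deriv c (dir_deriv c p) x) = (x \<bullet> x) * lap p x"
      unfolding inner_self_eq_sum[of x] lap_def sum_product ..
    moreover have E: "(\<Sum>b\<in>Basis. (x \<bullet> b) * dir_deriv b p x) = n * p x"
      using sum_inner_dir_deriv[OF p] euler_homogeneous[OF p h] by simp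
    moreover have "(\<Sum>b\<in>Basis. \<Sum>c\<in>Basis. (x \<bullet> b) * ((x \<bullet> c) * dir_deriv b (dir_deriv c p) x))
      = n * (real n - 1) * p x"
    proof -
      have "(\<Sum>b\<in>Basis. \<Sum>c\<in>Basis. (x \<bullet> b) * ((x \<bullet> c) * dir_deriv b (dir_deriv c p) x))
        = (\<Sum>c\<in>Basis. (x \<bullet> c) * (\<Sum>b\<in>Basis. (x \<bullet> b) * dir_deriv b (dir_deriv c p) x))"
        by (subst sum.swap) (simp add: sum_distrib_left mult.left_commute)
      also have "\<dots> = (\<Sum>c\<in>Basis. (x \<bullet> c) * (real (n - 1) * dir_deriv c p x))"
        using sum_inner_dir_deriv[OF real_polynomial_function_dir_deriv[OF p]]
          euler_homogeneous[OF real_polynomial_function_dir_deriv[OF p] homogeneous_dir_deriv[OF p h]] by simp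
      also have "\<dots> = real (n - 1) * (n * p x)"
        unfolding E[symmetric] by (simp add: sum_distrib_left mult.left_commute)
      also have "\<dots> = n * (real n - 1) * p x"
        by (cases n) auto
      finally show ?thesis .
    qed
    ultimately show ?thesis
      by (simp add: algebra_simps)
  qed
  have "(LINT x|\<sigma>. (\<Sum>b\<in>Basis. \<Sum>c\<in>Basis. rot_deriv b c (?q b c) x)) = 0"
  proof -
    have "integrable \<sigma> (rot_deriv b c (?q b c))" for b c
      unfolding rot_deriv_def using q
      by (intro integrable_poly real_polynomial_function_diff real_polynomial_function.intros(4)) auto
    then show ?thesis
      using integral_rot_deriv[OF _ _ q] by simp
  qed
  moreover have "(LINT x|\<sigma>. (\<Sum>b\<in>Basis. \<Sum>c\<in>Basis. rot_deriv b c (?q b c) x))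
      = (LINT x|\<sigma>. lap p x - n * (n + real DIM('a) - 2) * p x)"
    unfolding key by (rule integral_sphere_cong) (simp add: norm_eq_1)
  ultimately show ?thesis
    using integrable_poly[OF p] integrable_poly[OF real_polynomial_function_lap[OF p]] by simp
qed

end

section \<open>The Funk--Hecke formula\<close>

text \<open>The multiplier of \<open>t ^ k\<close> in degree \<open>l\<close>. The recursion is
  \<open>integral_homogeneous\<close> for \<open>(u \<bullet> v) ^ Suc k * Y v\<close>, solved for
  the integral: the first term stems from differentiating the power twice, the second from the mixed
  term, where Euler's relation at \<open>u\<close> supplies the factor \<open>l\<close>.\<close>

fun funk_hecke_power_coeff :: "nat \<Rightarrow> nat \<Rightarrow> nat \<Rightarrow> real" where
  "funk_hecke_power_coeff d 0 l = (if l = 0 then 1 else 0)"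
| "funk_hecke_power_coeff d (Suc k) l =
    (real (Suc k) * k * (if k = 0 then 0 else funk_hecke_power_coeff d (k - 1) l)
      + 2 * real (Suc k) * l * (if l = 0 then 0 else funk_hecke_power_coeff d k (l - 1)))
    / (real (Suc k + l) * (Suc k + l + real d - 2))"

lemma dir_deriv_power:
  assumes p: "real_polynomial_function p"
  shows "dir_deriv u (\<lambda>x. p x ^ n) = (\<lambda>x. n * p x ^ (n - 1) * dir_deriv u p x)"
proof
  fix x
  have "((\<lambda>x. p x ^ n) has_derivative (\<lambda>u. n * (dir_deriv u p x * p x ^ (n - 1)))) (at x)"
    using has_derivative_power[OF has_derivative_dir_deriv[OF p]] by (simp add: mult.assoc)
  from dir_deriv_eq[OF this]
  show "dir_deriv u (\<lambda>x. p x ^ n) x = n * p x ^ (n - 1) * dir_deriv u p x"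
    by (simp add: mult_ac)
qed

lemma real_polynomial_function_inner_power [intro]: "real_polynomial_function (\<lambda>x. (u \<bullet> x) ^ n)"
  by (intro real_polynomial_function_power) auto

lemma lap_inner_power:
  fixes u :: "'a::euclidean_space"
  shows "lap (\<lambda>x. (u \<bullet> x) ^ n) = (\<lambda>x. real n * (real n - 1) * (u \<bullet> u) * (u \<bullet> x) ^ (n - 2))"
proof
  fix x
  have "dir_deriv b (dir_deriv b (\<lambda>x. (u \<bullet> x) ^ n)) x
      = (u \<bullet> b) * (u \<bullet> b) * (real n * (real n - 1) * (u \<bullet> x) ^ (n - 2))" for b
  proof -
    have "dir_deriv b (\<lambda>x. (u \<bullet> x) ^ n) = (\<lambda>x. (n * (u \<bullet> b)) * (u \<bullet> x) ^ (n - 1))"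
      by (subst dir_deriv_power) (auto simp: mult_ac)
    then have "dir_deriv b (dir_deriv b (\<lambda>x. (u \<bullet> x) ^ n)) x =
        (n * (u \<bullet> b)) * (real (n - 1) * (u \<bullet> x) ^ (n - 1 - 1) * (u \<bullet> b))"
      by (simp add: dir_deriv_cmult dir_deriv_power real_polynomial_function_inner_power
          real_polynomial_function_inner)
    then show ?thesis
      by (cases n) (simp_all add: numeral_2_eq_2 mult_ac)
  qed
  then show "lap (\<lambda>x. (u \<bullet> x) ^ n) x = real n * (real n - 1) * (u \<bullet> u) * (u \<bullet> x) ^ (n - 2)"
    by (simp add: lap_def inner_self_eq_sum[of u] sum_distrib_left sum_distrib_right mult_ac)
qed

lemma lap_inner_power_mult:
  assumes Y: "real_polynomial_function Y" and harm: "lap Y = (\<lambda>x. 0)"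
  shows "lap (\<lambda>x. (u \<bullet> x) ^ n * Y x) =
    (\<lambda>x. real n * (real n - 1) * (u \<bullet> u) * ((u \<bullet> x) ^ (n - 2) * Y x)
       + 2 * real n * ((u \<bullet> x) ^ (n - 1) * dir_deriv u Y x))"
proof
  fix x
  have "(\<Sum>b\<in>Basis. dir_deriv b (\<lambda>x. (u \<bullet> x) ^ n) x * dir_deriv b Y x)
      = (\<Sum>b\<in>Basis. n * (u \<bullet> x) ^ (n - 1) * ((u \<bullet> b) * dir_deriv b Y x))"
    by (subst dir_deriv_power) (auto simp: mult_ac)
  also have "\<dots> = n * (u \<bullet> x) ^ (n - 1) * dir_deriv u Y x"
    using sum_inner_dir_deriv[OF Y, of u x] by (simp flip: sum_distrib_left)
  finally show "lap (\<lambda>x. (u \<bullet> x) ^ n * Y x) x =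
    real n * (real n - 1) * (u \<bullet> u) * ((u \<bullet> x) ^ (n - 2) * Y x)
       + 2 * real n * ((u \<bullet> x) ^ (n - 1) * dir_deriv u Y x)"
    using Y harm by (subst lap_mult) (auto simp: lap_inner_power)
qed

lemma inner_in_interval:
  "u \<in> sphere 0 1 \<Longrightarrow> v \<in> sphere 0 1 \<Longrightarrow> u \<bullet> v \<in> {-1..1}" for u v :: "'a::real_inner"
  using Cauchy_Schwarz_ineq2[of u v] by (auto simp: abs_le_iff)

context uniform_sphere
begin

lemma integral_harmonic:
  assumes "Y \<in> homogeneous_harmonic_polys l" "l \<noteq> 0"
  shows "(LINT x|\<sigma>. Y x) = 0"
  using integral_homogeneous[of Y l] assms dim by (auto simp: homogeneous_harmonic_polys_iff)

text \<open>The induction ranges over all harmonics and degrees at once, since the mixed term of the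
  Laplacian passes from \<open>Y\<close> to \<open>dir_deriv u Y\<close>, a harmonic of degree
  \<open>l - 1\<close> whose value at \<open>u\<close> is \<open>l * Y u\<close>.\<close>

lemma funk_hecke_power:
  assumes "Y \<in> homogeneous_harmonic_polys l" and "u \<in> unit_sphere"
  shows "(LINT v|\<sigma>. (u \<bullet> v) ^ k * Y v) = funk_hecke_power_coeff DIM('a) k l * Y u"
  using assms
proof (induction k arbitrary: l Y rule: less_induct)
  case (less k)
  then have Y: "real_polynomial_function Y" "homogeneous l Y" "lap Y = (\<lambda>x. 0)"
    by (auto simp: homogeneous_harmonic_polys_iff)
  have u: "u \<bullet> u = 1"
    using less.prems(2) by (simp add: norm_eq_1)
  show ?case
  proof (cases k)
    case 0
    show ?thesis
    proof (cases "l = 0")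
      case True
      define y where "y = Y 0"
      have "Y v = y" for v
        unfolding y_def by (rule homogeneous_0D) (use Y(2) True in simp)
      with 0 True show ?thesis by simp
    next
      case False
      with 0 integral_harmonic[OF less.prems(1)] show ?thesis by simp
    qed
  next
    case (Suc m)
    have poly: "real_polynomial_function (\<lambda>v. (u \<bullet> v) ^ i * Z v)" if "real_polynomial_function Z" for i Z
      using that by (intro real_polynomial_function.intros(4)) auto
    have DY: "dir_deriv u Y \<in> homogeneous_harmonic_polys (l - 1)"
      using Y homogeneous_dir_deriv by (auto simp: homogeneous_harmonic_polys_iff lap_dir_deriv)
    have "homogeneous (k + l) (\<lambda>v. (u \<bullet> v) ^ k * Y v)"
      using homogeneous_mult[OF homogeneous_power[OF homogeneous_inner] Y(2)] by simp
    from integral_homogeneous[OF poly[OF Y(1)] this]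
    have "real (k + l) * (k + l + real DIM('a) - 2) * (LINT v|\<sigma>. (u \<bullet> v) ^ k * Y v)
      = real k * (real k - 1) * (LINT v|\<sigma>. (u \<bullet> v) ^ (k - 2) * Y v)
        + 2 * real k * (LINT v|\<sigma>. (u \<bullet> v) ^ (k - 1) * dir_deriv u Y v)"
      unfolding lap_inner_power_mult[OF Y(1,3)] u
      using Y(1) integrable_poly[OF poly] by (simp add: real_polynomial_function_dir_deriv)
    moreover have "real k * (real k - 1) * (LINT v|\<sigma>. (u \<bullet> v) ^ (k - 2) * Y v)
      = real k * (real k - 1) * (if m = 0 then 0 else funk_hecke_power_coeff DIM('a) (m - 1) l) * Y u"
      using less.IH[of "k - 2" Y l] less.prems Suc by (cases m) auto
    moreover have "(LINT v|\<sigma>. (u \<bullet> v) ^ (k - 1) * dir_deriv u Y v)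
      = l * (if l = 0 then 0 else funk_hecke_power_coeff DIM('a) m (l - 1)) * Y u"
    proof (cases "l = 0")
      case True
      then show ?thesis using dir_deriv_homogeneous_0[of Y u] Y(2) by simp
    next
      case False
      then show ?thesis
        using less.IH[of m "dir_deriv u Y" "l - 1", OF _ DY less.prems(2)] Suc
        by (simp add: euler_homogeneous[OF Y(1,2)])
    qed
    ultimately have *: "real (k + l) * (k + l + real DIM('a) - 2) * (LINT v|\<sigma>. (u \<bullet> v) ^ k * Y v) =
      real k * (real k - 1) * (if m = 0 then 0 else funk_hecke_power_coeff DIM('a) (m - 1) l) * Y u +
       2 * real k * (l * (if l = 0 then 0 else funk_hecke_power_coeff DIM('a) m (l - 1)) * Y u)"
      by (simp only:)
    have "real (k + l) * (k + l + real DIM('a) - 2) \<noteq> 0"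
      using dim Suc by simp
    then have "(LINT v|\<sigma>. (u \<bullet> v) ^ k * Y v) =
      (real k * (real k - 1) * (if m = 0 then 0 else funk_hecke_power_coeff DIM('a) (m - 1) l) * Y u +
       2 * real k * (l * (if l = 0 then 0 else funk_hecke_power_coeff DIM('a) m (l - 1)) * Y u))
       / (real (k + l) * (k + l + real DIM('a) - 2))"
      unfolding *[symmetric] by (rule nonzero_mult_div_cancel_left[symmetric])
    then show ?thesis
      by (simp add: Suc add_divide_distrib distrib_right)
  qed
qed

lemma funk_hecke_polynomial:
  assumes "real_polynomial_function \<psi>"
  obtains c where "\<And>Y (u :: 'a). Y \<in> homogeneous_harmonic_polys l \<Longrightarrow> u \<in> unit_sphere \<Longrightarrow>
    (LINT v|\<sigma>. \<psi> (u \<bullet> v) * Y v) = c * Y u"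
proof -
  obtain a n where \<psi>: "\<psi> = (\<lambda>x. \<Sum>i\<le>n. a i * x ^ i)"
    using assms real_polynomial_function_iff_sum by blast
  show thesis
  proof
    fix Y :: "'a \<Rightarrow> real" and u :: 'a
    assume Y: "Y \<in> homogeneous_harmonic_polys l" and u: "u \<in> unit_sphere"
    have int: "integrable \<sigma> (\<lambda>v. (u \<bullet> v) ^ i * Y v)" for i
      using Y by (intro integrable_poly real_polynomial_function.intros(4))
        (auto simp: homogeneous_harmonic_polys_iff)
    have "(LINT v|\<sigma>. \<psi> (u \<bullet> v) * Y v) = (LINT v|\<sigma>. (\<Sum>i\<le>n. a i * ((u \<bullet> v) ^ i * Y v)))"
      by (simp add: \<psi> sum_distrib_right mult.assoc)
    also have "\<dots> = (\<Sum>i\<le>n. a i * funk_hecke_power_coeff DIM('a) i l) * Y u"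
      using int by (simp add: funk_hecke_power[OF Y u] sum_distrib_right mult.assoc)
    finally show "(LINT v|\<sigma>. \<psi> (u \<bullet> v) * Y v) = (\<Sum>i\<le>n. a i * funk_hecke_power_coeff DIM('a) i l) * Y u" .
  qed
qed

section \<open>The Funk--Hecke formula for continuous kernels\<close>

lemma continuous_on_zonal:
  assumes "continuous_on {-1..1} \<psi>" "u \<in> unit_sphere"
  shows "continuous_on unit_sphere (\<lambda>v::'a. \<psi> (u \<bullet> v) :: real)"
  by (rule continuous_on_compose2[OF assms(1)]) (use inner_in_interval[OF assms(2)] in \<open>auto intro!: continuous_intros\<close>)

lemma continuous_on_harmonic:
  "Y \<in> homogeneous_harmonic_polys l \<Longrightarrow> continuous_on unit_sphere Y"
  by (auto simp: homogeneous_harmonic_polys_iff intro: real_polynomial_function_continuous_on)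

text \<open>For a polynomial kernel both sides equal \<open>c * Y u * Z w\<close>. In this form the
  unknown \<open>c\<close>, which changes with the approximating polynomial, has cancelled, so
  uniform approximation of \<open>\<psi>\<close> suffices and no limit of multipliers has to be
  taken.\<close>

lemma funk_hecke_cross:
  assumes \<psi>: "continuous_on {-1..1} \<psi>"
    and Y: "Y \<in> homogeneous_harmonic_polys l" "u \<in> unit_sphere"
    and Z: "Z \<in> homogeneous_harmonic_polys l" "w \<in> unit_sphere"
  shows "(LINT v|\<sigma>. \<psi> (u \<bullet> v) * Y v) * Z w = (LINT v|\<sigma>. \<psi> (w \<bullet> v) * Z v) * Y u"
    (is "?I u Y * _ = _")
proof -
  obtain B where B: "0 \<le> B" "\<And>x. x \<in> unit_sphere \<Longrightarrow> \<bar>Y x\<bar> \<le> B"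
    using bounded_on_sphere continuous_on_harmonic[OF Y(1)] by blast
  obtain C where C: "0 \<le> C" "\<And>x. x \<in> unit_sphere \<Longrightarrow> \<bar>Z x\<bar> \<le> C"
    using bounded_on_sphere continuous_on_harmonic[OF Z(1)] by blast
  have "\<bar>?I u Y * Z w - ?I w Z * Y u\<bar> \<le> e" if "0 < e" for e
  proof -
    \<comment> \<open>The two sides will differ by at most \<open>\<delta> * (2 * B * C)\<close>;
      the \<open>+ 1\<close> guards against a zero denominator.\<close>
    define \<delta> where "\<delta> = e / (2 * B * C + 1)"
    have BC: "0 \<le> B * C"
      using B(1) C(1) by simp
    with that have "0 < \<delta>"
      by (simp add: \<delta>_def)
    then obtain \<phi> where \<phi>: "real_polynomial_function \<phi>" "\<And>x. x \<in> {-1..1} \<Longrightarrow> \<bar>\<psi> x - \<phi> x\<bar> < \<delta>"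
      using Stone_Weierstrass_real_polynomial_function[OF _ \<psi>] by blast
    obtain c where c: "\<And>Y (u :: 'a). Y \<in> homogeneous_harmonic_polys l \<Longrightarrow> u \<in> unit_sphere \<Longrightarrow>
        (LINT v|\<sigma>. \<phi> (u \<bullet> v) * Y v) = c * Y u"
      using funk_hecke_polynomial[OF \<phi>(1)] by blast
    have approx: "\<bar>?I x V - c * V x\<bar> \<le> \<delta> * D"
      if V: "V \<in> homogeneous_harmonic_polys l" and x: "x \<in> unit_sphere"
        and D: "\<And>x. x \<in> unit_sphere \<Longrightarrow> \<bar>V x\<bar> \<le> D" for V x D
    proof -
      have \<phi>c: "continuous_on {-1..1} \<phi>"
        using \<phi>(1) by (rule real_polynomial_function_continuous_on)
      have int: "integrable \<sigma> (\<lambda>v. \<psi> (x \<bullet> v) * V v)" "integrable \<sigma> (\<lambda>v. \<phi> (x \<bullet> v) * V v)"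
        using V x \<psi> \<phi>c
        by (auto intro!: integrable_continuous continuous_on_mult continuous_on_zonal
            intro: continuous_on_harmonic simp del: mem_sphere)
      then have "\<bar>?I x V - c * V x\<bar> = \<bar>LINT v|\<sigma>. \<psi> (x \<bullet> v) * V v - \<phi> (x \<bullet> v) * V v\<bar>"
        using c[OF V x] by simp
      also have "\<dots> \<le> (LINT v|\<sigma>. \<bar>\<psi> (x \<bullet> v) * V v - \<phi> (x \<bullet> v) * V v\<bar>)"
        by (rule integral_abs_bound)
      also have "\<dots> \<le> (LINT v|\<sigma>. \<delta> * D)"
      proof (rule integral_mono)
        fix v assume "v \<in> space \<sigma>"
        then have v: "v \<in> unit_sphere" by (simp add: space_eq)
        have "\<bar>\<psi> (x \<bullet> v) * V v - \<phi> (x \<bullet> v) * V v\<bar> = \<bar>\<psi> (x \<bullet> v) - \<phi> (x \<bullet> v)\<bar> * \<bar>V v\<bar>"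
          by (simp add: abs_mult[symmetric] left_diff_distrib)
        also have "\<dots> \<le> \<delta> * D"
          using \<phi>(2)[OF inner_in_interval[OF x v]] D[OF v] \<open>0 < \<delta>\<close> by (intro mult_mono) auto
        finally show "\<bar>\<psi> (x \<bullet> v) * V v - \<phi> (x \<bullet> v) * V v\<bar> \<le> \<delta> * D" .
      qed (use int in auto)
      finally show ?thesis by simp
    qed
    have "?I u Y * Z w - ?I w Z * Y u = (?I u Y - c * Y u) * Z w - (?I w Z - c * Z w) * Y u"
      by (simp add: algebra_simps)
    also have "\<bar>\<dots>\<bar> \<le> \<bar>?I u Y - c * Y u\<bar> * \<bar>Z w\<bar> + \<bar>?I w Z - c * Z w\<bar> * \<bar>Y u\<bar>"
      by (simp add: abs_mult[symmetric])
    also have "\<dots> \<le> (\<delta> * B) * C + (\<delta> * C) * B"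
      using approx[OF Y B(2)] approx[OF Z C(2)] B(2)[OF Y(2)] C(2)[OF Z(2)] B(1) C(1) \<open>0 < \<delta>\<close>
      by (intro add_mono mult_mono) auto
    also have "\<dots> = \<delta> * (2 * B * C)"
      by (simp add: algebra_simps)
    also have "\<dots> \<le> e"
      using BC that by (simp add: \<delta>_def divide_simps)
    finally show ?thesis .
  qed
  then have "\<bar>?I u Y * Z w - ?I w Z * Y u\<bar> \<le> 0"
    by (rule field_le_epsilon) simp
  then show ?thesis by simp
qed

lemma spherical_harmonics_funk_hecke_iff:
  "(\<forall>Y\<in>spherical_harmonics l. \<forall>u\<in>unit_sphere. (LINT v|\<sigma>. \<psi> (u \<bullet> v) * Y v) = c * Y u) \<longleftrightarrow>
   (\<forall>Y\<in>homogeneous_harmonic_polys l. \<forall>u\<in>unit_sphere. (LINT v|\<sigma>. \<psi> (u \<bullet> v) * Y v) = c * Y u)"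
proof -
  have "(LINT v|\<sigma>. \<psi> (u \<bullet> v) * restrict p unit_sphere v) = (LINT v|\<sigma>. \<psi> (u \<bullet> v) * p v)" for p u
    by (rule integral_sphere_cong) simp
  then show ?thesis
    by (simp add: spherical_harmonics_def del: mem_sphere)
qed

text \<open>A single pair \<open>Z\<close>, \<open>w\<close> with \<open>Z w \<noteq> 0\<close>
  fixes the scalar: \<open>funk_hecke_cross\<close> makes the quotient at that pair valid for every
  \<open>Y\<close> and \<open>u\<close>, and \<open>Z w \<noteq> 0\<close> makes it unique, which
  resolves the \<open>THE\<close>.\<close>

lemma funk_hecke:
  assumes \<psi>: "continuous_on {-1..1} \<psi>"
    and Y: "Y \<in> homogeneous_harmonic_polys l" and u: "u \<in> unit_sphere"
  shows "(LINT v|\<sigma>. \<psi> (u \<bullet> v) * Y v) = funk_hecke_multiplier \<sigma> \<psi> l * Y u"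
proof (cases "\<exists>Z\<in>homogeneous_harmonic_polys l. \<exists>w\<in>(unit_sphere :: 'a set). Z w \<noteq> 0")
  case True
  then obtain Z and w :: 'a where Z: "Z \<in> homogeneous_harmonic_polys l" "w \<in> unit_sphere" "Z w \<noteq> 0"
    by blast
  define c where "c = (LINT v|\<sigma>. \<psi> (w \<bullet> v) * Z v) / Z w"
  have c: "\<forall>Y\<in>homogeneous_harmonic_polys l. \<forall>u\<in>unit_sphere. (LINT v|\<sigma>. \<psi> (u \<bullet> v) * Y v) = c * Y u"
    using funk_hecke_cross[OF \<psi> _ _ Z(1,2)] Z(3) by (simp add: c_def field_simps del: mem_sphere)
  have "funk_hecke_multiplier \<sigma> \<psi> l = c"
    unfolding funk_hecke_multiplier_def spherical_harmonics_funk_hecke_iff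
  proof (rule the_equality)
    show "\<forall>Y\<in>homogeneous_harmonic_polys l. \<forall>u\<in>unit_sphere. (LINT v|\<sigma>. \<psi> (u \<bullet> v) * Y v) = c * Y u"
      by (rule c)
  next
    fix c'
    assume "\<forall>Y\<in>homogeneous_harmonic_polys l. \<forall>u\<in>unit_sphere. (LINT v|\<sigma>. \<psi> (u \<bullet> v) * Y v) = c' * Y u"
    with c Z have "c' * Z w = c * Z w" by metis
    with Z(3) show "c' = c" by simp
  qed
  with c Y u show ?thesis by blast
next
  \<comment> \<open>Here every scalar satisfies the defining property, so \<open>THE\<close> yields an unspecified value.\<close>
  case False
  then have "(LINT v|\<sigma>. \<psi> (u \<bullet> v) * Y v) = (LINT v|\<sigma>. 0)"
    using Y by (intro integral_sphere_cong) auto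
  with False Y u show ?thesis by auto
qed

end

section \<open>Harmonic decomposition of polynomials on the sphere\<close>

text \<open>Decomposition into homogeneous parts in inductive form. Degrees are unordered and may
  repeat, so that products merely distribute and equal degrees are never regrouped.\<close>

inductive homogeneous_sum :: "('a::euclidean_space \<Rightarrow> real) \<Rightarrow> bool" where
  base: "real_polynomial_function p \<Longrightarrow> homogeneous n p \<Longrightarrow> homogeneous_sum p"
| add: "homogeneous_sum p \<Longrightarrow> homogeneous_sum q \<Longrightarrow> homogeneous_sum (\<lambda>x. p x + q x)"

lemma homogeneous_sum_mult:
  assumes "homogeneous_sum p" "homogeneous_sum q"
  shows "homogeneous_sum (\<lambda>x. p x * q x)"
  using assms
proof induction
  case (base p n)
  from \<open>homogeneous_sum q\<close> show ?case
  proof induction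
    case (base q m)
    then show ?case
      using \<open>real_polynomial_function p\<close> homogeneous_mult[OF \<open>homogeneous n p\<close> base(2)]
      by (intro homogeneous_sum.base) auto
  next
    case (add q r)
    then show ?case
      using homogeneous_sum.add by (simp add: distrib_left)
  qed
next
  case (add p r)
  then show ?case
    using homogeneous_sum.add by (simp add: distrib_right)
qed

lemma homogeneous_sum_polynomial: "real_polynomial_function p \<Longrightarrow> homogeneous_sum p"
proof (induction rule: real_polynomial_function.induct)
  case (linear f)
  then have "homogeneous 1 f"
    by (simp add: homogeneous_def linear_cmul bounded_linear.linear)
  with linear show ?case
    by (auto intro: homogeneous_sum.base)
next
  case (const c)
  have "homogeneous 0 (\<lambda>x. c)"
    by (simp add: homogeneous_def)
  then show ?case
    by (auto intro: homogeneous_sum.base)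
qed (auto intro: homogeneous_sum.add homogeneous_sum_mult)

text \<open>Of the constant, \<open>2 * DIM('a)\<close> is the Laplacian of
  \<open>x \<bullet> x\<close> and \<open>4 * m\<close> is the mixed term evaluated by Euler's
  relation.\<close>

lemma lap_inner_self_mult:
  fixes q :: "'a::euclidean_space \<Rightarrow> real"
  assumes q: "real_polynomial_function q" "homogeneous m q"
  shows "lap (\<lambda>x. (x \<bullet> x) * q x) = (\<lambda>x. (2 * DIM('a) + 4 * m) * q x + (x \<bullet> x) * lap q x)"
proof
  fix x :: 'a
  have "dir_deriv b (dir_deriv b (\<lambda>x::'a. x \<bullet> x)) = (\<lambda>x. 2)" if "b \<in> Basis" for b :: 'a
    using that by (simp add: dir_deriv_cmult real_polynomial_function_inner)
  then have "lap (\<lambda>x::'a. x \<bullet> x) x = 2 * DIM('a)"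
    by (simp add: lap_def)
  moreover have "(\<Sum>b\<in>Basis. dir_deriv b (\<lambda>x::'a. x \<bullet> x) x * dir_deriv b q x) = 2 * m * q x"
    using sum_inner_dir_deriv[OF q(1), of x x] euler_homogeneous[OF q, of x]
    by (simp add: mult.assoc flip: sum_distrib_left)
  ultimately show "lap (\<lambda>x. (x \<bullet> x) * q x) x = (2 * DIM('a) + 4 * m) * q x + (x \<bullet> x) * lap q x"
    using q(1) by (subst lap_mult) (auto simp: algebra_simps)
qed

lemma lap_inner_self_power_mult:
  fixes q :: "'a::euclidean_space \<Rightarrow> real"
  assumes q: "q \<in> homogeneous_harmonic_polys m"
  shows "lap (\<lambda>x. (x \<bullet> x) ^ j * q x) =
    (\<lambda>x. 2 * real j * (2 * j + 2 * m + real DIM('a) - 2) * ((x \<bullet> x) ^ (j - 1) * q x))"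
proof (induction j)
  case 0
  then show ?case using q by (simp add: homogeneous_harmonic_polys_iff)
next
  case (Suc j)
  have "real_polynomial_function (\<lambda>x. (x \<bullet> x) ^ j * q x)"
    using q by (intro real_polynomial_function.intros(4) real_polynomial_function_power)
      (auto simp: homogeneous_harmonic_polys_iff)
  moreover have "homogeneous (2 * j + m) (\<lambda>x. (x \<bullet> x) ^ j * q x)"
    using q by (intro homogeneous_mult homogeneous_power homogeneous_inner_self)
      (simp add: homogeneous_harmonic_polys_iff)
  ultimately have "lap (\<lambda>x. (x \<bullet> x) * ((x \<bullet> x) ^ j * q x)) =
    (\<lambda>x. (2 * DIM('a) + 4 * (2 * j + m)) * ((x \<bullet> x) ^ j * q x)
      + (x \<bullet> x) * (2 * real j * (2 * j + 2 * m + real DIM('a) - 2) * ((x \<bullet> x) ^ (j - 1) * q x)))"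
    by (simp add: lap_inner_self_mult Suc.IH)
  also have "\<dots> = (\<lambda>x. 2 * real (Suc j) * (2 * Suc j + 2 * m + real DIM('a) - 2) * ((x \<bullet> x) ^ j * q x))"
    by (cases j) (auto simp: fun_eq_iff algebra_simps)
  finally show ?case
    by (simp add: mult.assoc)
qed

lemma real_polynomial_function_lap_funpow [intro]:
  "real_polynomial_function p \<Longrightarrow> real_polynomial_function ((lap ^^ j) p)"
  by (induction j) auto

lemma lap_funpow_cmult:
  "real_polynomial_function p \<Longrightarrow> (lap ^^ j) (\<lambda>x. c * p x) = (\<lambda>x. c * (lap ^^ j) p x)"
  by (induction j) (simp_all add: lap_cmult real_polynomial_function_lap_funpow)

lemma lap_funpow_add:
  "real_polynomial_function p \<Longrightarrow> real_polynomial_function q \<Longrightarrow>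
    (lap ^^ j) (\<lambda>x. p x + q x) = (\<lambda>x. (lap ^^ j) p x + (lap ^^ j) q x)"
  by (induction j) (simp_all add: lap_add real_polynomial_function_lap_funpow)

text \<open>Each Laplacian strips one factor \<open>x \<bullet> x\<close> at the price of a constant
  that is positive for \<open>2 \<le> DIM('a)\<close>. Since \<open>c\<close> is nonzero, a multiple
  of this product can cancel any prescribed multiple of \<open>q\<close>.\<close>

lemma lap_funpow_inner_self_power_mult:
  fixes q :: "'a::euclidean_space \<Rightarrow> real"
  assumes q: "q \<in> homogeneous_harmonic_polys m" and d: "2 \<le> DIM('a)"
  shows "\<exists>c>0. (lap ^^ j) (\<lambda>x. (x \<bullet> x) ^ j * q x) = (\<lambda>x. c * q x)"
proof (induction j)
  case 0
  then show ?case by (auto intro: exI[of _ 1])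
next
  case (Suc j)
  then obtain c where c: "0 < c" "(lap ^^ j) (\<lambda>x. (x \<bullet> x) ^ j * q x) = (\<lambda>x. c * q x)"
    by blast
  have poly: "real_polynomial_function (\<lambda>x. (x \<bullet> x) ^ j * q x)"
    using q by (intro real_polynomial_function.intros(4) real_polynomial_function_power)
      (auto simp: homogeneous_harmonic_polys_iff)
  define e where "e = 2 * real (Suc j) * (2 * Suc j + 2 * m + real DIM('a) - 2)"
  have "(lap ^^ Suc j) (\<lambda>x. (x \<bullet> x) ^ Suc j * q x) = (lap ^^ j) (\<lambda>x. e * ((x \<bullet> x) ^ j * q x))"
    by (simp only: funpow_Suc_right comp_apply lap_inner_self_power_mult[OF q] e_def diff_Suc_1
        of_nat_add of_nat_mult of_nat_numeral)
  also have "\<dots> = (\<lambda>x. e * c * q x)"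
    by (simp only: lap_funpow_cmult[OF poly] c(2) mult.assoc)
  finally show ?case
    using c(1) d by (intro exI[of _ "e * c"]) (simp add: e_def)
qed

lemma homogeneous_lap_funpow:
  "real_polynomial_function p \<Longrightarrow> homogeneous n p \<Longrightarrow> homogeneous (n - 2 * j) ((lap ^^ j) p)"
proof (induction j)
  case (Suc j)
  then have "homogeneous (n - 2 * j - 2) (lap ((lap ^^ j) p))"
    by (intro homogeneous_lap) auto
  then show ?case by simp
qed simp

lemma lap_funpow_eq_0:
  assumes "real_polynomial_function p" "homogeneous n p" "n < 2 * j"
  shows "(lap ^^ j) p = (\<lambda>x. 0)"
proof (cases j)
  case (Suc i)
  then show ?thesis
    using assms homogeneous_lap_funpow[OF assms(1,2), of i]
    by (auto intro: lap_homogeneous_less_2)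
qed (use assms in simp)

text \<open>If \<open>q = lap\<^sup>k p\<close> is harmonic, then \<open>p\<close> minus a multiple of \<open>\<bar>x\<bar>\<^sup>2\<^sup>k q\<close> is annihilated by
  \<open>lap\<^sup>k\<close>, and \<open>\<bar>x\<bar>\<^sup>2\<^sup>k q\<close> agrees with \<open>q\<close> on the sphere.\<close>

lemma polynomial_sphere_induct:
  fixes p :: "'a::euclidean_space \<Rightarrow> real"
  assumes d: "2 \<le> DIM('a)" and p: "real_polynomial_function p"
    and harm: "\<And>l Y. Y \<in> homogeneous_harmonic_polys l \<Longrightarrow> P Y"
    and add: "\<And>p q. real_polynomial_function p \<Longrightarrow> real_polynomial_function q \<Longrightarrow>
       P p \<Longrightarrow> P q \<Longrightarrow> P (\<lambda>x. p x + q x)"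
    and cong: "\<And>p q. (\<And>x. x \<in> unit_sphere \<Longrightarrow> p x = q x) \<Longrightarrow> P p \<Longrightarrow> P q"
  shows "P p"
proof -
  have hom: "P p" if "real_polynomial_function p" "homogeneous n p" "(lap ^^ k) p = (\<lambda>x. 0)" for k n p
    using that
  proof (induction k arbitrary: p)
    case 0
    then have "p \<in> homogeneous_harmonic_polys n"
      by (simp add: homogeneous_harmonic_polys_iff)
    then show ?case by (rule harm)
  next
    case (Suc k)
    define q where "q = (lap ^^ k) p"
    show ?case
    proof (cases "2 * k \<le> n")
      \<comment> \<open>The degree is too small for \<open>k\<close> Laplacians to leave anything,
        so \<open>p\<close> itself already falls under the induction hypothesis.\<close>
      case False
      then show ?thesis
        using Suc lap_funpow_eq_0[of p n k] by simp
    next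
      case True
      have q: "q \<in> homogeneous_harmonic_polys (n - 2 * k)"
        using Suc.prems homogeneous_lap_funpow[of p n k]
        by (auto simp: homogeneous_harmonic_polys_iff q_def)
      obtain c where c: "0 < c" "(lap ^^ k) (\<lambda>x. (x \<bullet> x) ^ k * q x) = (\<lambda>x. c * q x)"
        using lap_funpow_inner_self_power_mult[OF q d] by blast
      \<comment> \<open>Scaled so that \<open>(lap ^^ k) r = - q\<close>; then \<open>p + r\<close>
        is annihilated by \<open>lap ^^ k\<close>.\<close>
      define r where "r x = (- 1 / c) * ((x \<bullet> x) ^ k * q x)" for x
      have poly: "real_polynomial_function (\<lambda>x. (x \<bullet> x) ^ k * q x)"
        using q by (intro real_polynomial_function.intros(4) real_polynomial_function_power)
          (auto simp: homogeneous_harmonic_polys_iff)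
      then have r: "real_polynomial_function r"
        unfolding r_def by (rule real_polynomial_function.intros(4)[OF real_polynomial_function.intros(2)])
      have "homogeneous (2 * k + (n - 2 * k)) (\<lambda>x. (x \<bullet> x) ^ k * q x)"
        using q by (intro homogeneous_mult homogeneous_power homogeneous_inner_self)
          (simp add: homogeneous_harmonic_polys_iff)
      then have "homogeneous n r"
        using True by (simp add: homogeneous_def r_def)
      moreover have "(lap ^^ k) r = (\<lambda>x. - q x)"
        unfolding r_def lap_funpow_cmult[OF poly] c(2) using c(1) by simp
      ultimately have "P (\<lambda>x. p x + r x)"
        using Suc.prems r
        by (intro Suc.IH) (auto simp: lap_funpow_add homogeneous_def distrib_left q_def)
      moreover have "P (\<lambda>x. - r x)"
      proof (rule cong)
        have "(\<lambda>x. (1 / c) * q x) \<in> homogeneous_harmonic_polys (n - 2 * k)"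
          unfolding homogeneous_harmonic_polys_iff
        proof (intro conjI)
          show "lap (\<lambda>x. (1 / c) * q x) = (\<lambda>x. 0)"
            using q lap_cmult[of q "1 / c"] by (simp add: homogeneous_harmonic_polys_iff)
        qed (use q in \<open>auto simp: homogeneous_harmonic_polys_iff homogeneous_def\<close>)
        then show "P (\<lambda>x. (1 / c) * q x)"
          by (rule harm)
      qed (simp add: r_def norm_eq_1)
      ultimately have "P (\<lambda>x. (p x + r x) + - r x)"
        using Suc.prems r add[of "\<lambda>x. p x + r x" "\<lambda>x. - r x"] by auto
      then show ?thesis by simp
    qed
  qed
  from homogeneous_sum_polynomial[OF p]
  have "real_polynomial_function p \<and> P p"
  proof induction
    case (base p n)
    \<comment> \<open>\<open>Suc n\<close> Laplacians annihilate every homogeneous polynomial of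
      degree \<open>n\<close>, since \<open>n < 2 * Suc n\<close>.\<close>
    then show ?case
      using hom[of p n "Suc n"] lap_funpow_eq_0[of p n "Suc n"] by auto
  next
    case (add p q)
    then show ?case using assms(4) by auto
  qed
  then show ?thesis ..
qed

section \<open>The dimension of the space of harmonics\<close>

text \<open>A word serves as a multi-index: a letter can be split off at any position, and
  \<open>word_deriv_move\<close> makes the order immaterial.\<close>

definition word_deriv :: "'a::euclidean_space list \<Rightarrow> ('a \<Rightarrow> real) \<Rightarrow> 'a \<Rightarrow> real" where
  "word_deriv w p = foldr dir_deriv w p"

lemma word_deriv_simps [simp]:
  "word_deriv [] p = p" "word_deriv (b # w) p = dir_deriv b (word_deriv w p)"
  by (simp_all add: word_deriv_def)

lemma real_polynomial_function_word_deriv [intro]: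
  "real_polynomial_function p \<Longrightarrow> real_polynomial_function (word_deriv w p)"
  by (induction w) auto

lemma word_deriv_move:
  "real_polynomial_function p \<Longrightarrow> word_deriv (ys @ b # zs) p = dir_deriv b (word_deriv (ys @ zs) p)"
  by (induction ys) (auto intro: dir_deriv_commute)

lemma word_deriv_dir_deriv:
  "real_polynomial_function p \<Longrightarrow> word_deriv w (dir_deriv b p) = dir_deriv b (word_deriv w p)"
  by (induction w) (auto intro: dir_deriv_commute)

lemma lap_word_deriv:
  "real_polynomial_function p \<Longrightarrow> lap (word_deriv w p) = word_deriv w (lap p)"
  by (induction w) (auto simp: lap_dir_deriv real_polynomial_function_word_deriv)

lemma word_deriv_linear:
  assumes "real_polynomial_function p" "real_polynomial_function q"
  shows "word_deriv w (\<lambda>x. p x + c * q x) = (\<lambda>x. word_deriv w p x + c * word_deriv w q x)"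
proof (induction w)
  case (Cons b w)
  have "real_polynomial_function (\<lambda>x. c * word_deriv w q x)"
    using assms by (intro real_polynomial_function.intros(4)) auto
  with assms Cons show ?case
    by (simp add: dir_deriv_add dir_deriv_cmult real_polynomial_function_word_deriv)
qed simp

lemma word_deriv_zero: "word_deriv w (\<lambda>x. 0) = (\<lambda>x. 0)"
  by (induction w) auto

text \<open>Each multiset of \<open>l\<close> letters, that is, each monomial of degree
  \<open>l\<close>, appears once as a word sorted along \<open>bs\<close>. Either the first letter
  is absent, or one copy is split off and further copies stay allowed; for the lengths this is
  Pascal's rule.\<close>

fun sorted_words :: "'b list \<Rightarrow> nat \<Rightarrow> 'b list list" where
  "sorted_words bs 0 = [[]]"
| "sorted_words [] (Suc l) = []"
| "sorted_words (b # bs) (Suc l) = sorted_words bs (Suc l) @ map ((#) b) (sorted_words (b # bs) l)"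

lemma length_sorted_words: "length (sorted_words bs l) = (length bs + l - 1) choose l"
  by (induction bs l rule: sorted_words.induct) (simp_all add: choose_reduce_nat)

text \<open>Derivatives commute, so an occurring letter \<open>b\<close> can be moved next to
  \<open>p\<close>. The induction then continues with \<open>dir_deriv b p\<close> in place of
  \<open>p\<close>, for which reason \<open>p\<close> is kept arbitrary.\<close>

lemma word_deriv_eq_0_from_sorted:
  assumes "real_polynomial_function p" and "\<And>w. w \<in> set (sorted_words bs l) \<Longrightarrow> word_deriv w p x = 0"
    and "set w \<subseteq> set bs" "length w = l"
  shows "word_deriv w p x = 0"
  using assms
proof (induction bs l arbitrary: p w rule: sorted_words.induct)
  case (3 b bs l)
  show ?case
  proof (cases "b \<in> set w")
    case True
    then obtain ys zs where w: "w = ys @ b # zs"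
      by (meson split_list)
    have "word_deriv (ys @ zs) (dir_deriv b p) x = 0"
    proof (rule "3.IH"(2))
      fix v assume "v \<in> set (sorted_words (b # bs) l)"
      then show "word_deriv v (dir_deriv b p) x = 0"
        using "3.prems"(2)[of "b # v"] "3.prems"(1) by (simp add: word_deriv_dir_deriv)
    qed (use "3.prems"(1,3,4) in \<open>simp_all add: w real_polynomial_function_dir_deriv\<close>)
    then show ?thesis
      using "3.prems"(1) by (simp add: w word_deriv_move word_deriv_dir_deriv)
  next
    case False
    show ?thesis
    proof (rule "3.IH"(1))
      show "set w \<subseteq> set bs"
        using False "3.prems"(3) by auto
      show "word_deriv v p x = 0" if "v \<in> set (sorted_words bs (Suc l))" for v
        using "3.prems"(2)[of v] that by simp
    qed (fact "3.prems")+
  qed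
qed auto

text \<open>Two letters \<open>e\<close> are exchanged, by harmonicity, for minus the sum of the
  pairs \<open>b\<close>, \<open>b\<close> over the other basis vectors, which lowers the number of
  letters \<open>e\<close> by two. Words with no \<open>e\<close> or a single one remain, and
  sorting reduces these to the hypotheses.\<close>

lemma harmonic_word_deriv_eq_0:
  assumes p: "real_polynomial_function p" and harm: "lap p = (\<lambda>x. 0)"
    and basis: "set (e # bs) = Basis" "distinct (e # bs)"
    and w0: "\<And>w. w \<in> set (sorted_words bs l) \<Longrightarrow> word_deriv w p x = 0"
    and w1: "\<And>w. l \<noteq> 0 \<Longrightarrow> w \<in> set (sorted_words bs (l - 1)) \<Longrightarrow> word_deriv (e # w) p x = 0"
    and w: "set w \<subseteq> Basis" "length w = l"
  shows "word_deriv w p x = 0"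
  using w
proof (induction "count_list w e" arbitrary: w rule: less_induct)
  case less
  show ?case
  proof (cases "e \<in> set w")
    case False
    then show ?thesis
      using less.prems basis(1) by (intro word_deriv_eq_0_from_sorted[OF p w0]) auto
  next
    case True
    then obtain ys zs where w: "w = ys @ e # zs"
      by (meson split_list)
    define v where "v = ys @ zs"
    have wv: "word_deriv w p = word_deriv (e # v) p" "count_list w e = Suc (count_list v e)"
      and v: "set v \<subseteq> Basis" "Suc (length v) = l"
      using p less.prems by (auto simp: w v_def word_deriv_move)
    show ?thesis
    proof (cases "e \<in> set v")
      case False
      have "word_deriv v (dir_deriv e p) x = 0"
      proof (rule word_deriv_eq_0_from_sorted)
        fix u assume "u \<in> set (sorted_words bs (l - 1))"
        then show "word_deriv u (dir_deriv e p) x = 0"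
          using w1[of u] v(2) p by (simp add: word_deriv_dir_deriv)
      qed (use v False p basis(1) in auto)
      then show ?thesis
        using wv(1) p by (simp add: word_deriv_dir_deriv)
    next
      case True
      then obtain ys zs where v': "v = ys @ e # zs"
        by (meson split_list)
      define u where "u = ys @ zs"
      have vu: "word_deriv v p = dir_deriv e (word_deriv u p)" "count_list v e = Suc (count_list u e)"
        and u: "set u \<subseteq> Basis" "Suc (length u) = length v"
        using p v by (auto simp: v' u_def word_deriv_move)
      have "word_deriv (b # b # u) p x = 0" if "b \<in> set bs" for b
        using that basis u v less.prems wv vu by (intro less.hyps) auto
      then have "(\<Sum>b\<in>set bs. dir_deriv b (dir_deriv b (word_deriv u p)) x) = 0"
        by simp
      moreover have "lap (word_deriv u p) x = 0"
        by (simp add: lap_word_deriv[OF p] harm word_deriv_zero)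
      moreover have "lap (word_deriv u p) x = dir_deriv e (dir_deriv e (word_deriv u p)) x
        + (\<Sum>b\<in>set bs. dir_deriv b (dir_deriv b (word_deriv u p)) x)"
        using basis(2) by (simp add: lap_def basis(1)[symmetric])
      ultimately show ?thesis
        using wv(1) vu(1) by simp
    qed
  qed
qed

text \<open>The derivatives of order \<open>l\<close> at 0 play the part of coefficients: by
  induction all first derivatives vanish, and Euler's relation recovers \<open>p\<close> from
  them.\<close>

lemma homogeneous_eq_0:
  assumes "real_polynomial_function p" "homogeneous l p"
    and "\<And>w. set w \<subseteq> Basis \<Longrightarrow> length w = l \<Longrightarrow> word_deriv w p 0 = 0"
  shows "p = (\<lambda>x. 0)"
  using assms
proof (induction l arbitrary: p)
  case 0
  show ?case
  proof
    fix x
    have "p x = p 0"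
      by (rule homogeneous_0D) (rule 0(2))
    also have "\<dots> = 0"
      using 0(3)[of "[]"] by simp
    finally show "p x = 0" .
  qed
next
  case (Suc l)
  have "dir_deriv b p = (\<lambda>x. 0)" if "b \<in> Basis" for b
  proof (rule Suc.IH)
    show "homogeneous l (dir_deriv b p)"
      using homogeneous_dir_deriv[OF Suc.prems(1,2)] by simp
    fix w :: "'a list" assume "set w \<subseteq> Basis" "length w = l"
    then show "word_deriv w (dir_deriv b p) 0 = 0"
      using Suc.prems(1) Suc.prems(3)[of "b # w"] that by (simp add: word_deriv_dir_deriv)
  qed (use Suc.prems(1) in auto)
  then have "real (Suc l) * p x = 0" for x
    using sum_inner_dir_deriv[OF Suc.prems(1), of x x] euler_homogeneous[OF Suc.prems(1,2), of x] by simp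
  then show ?case by (simp add: fun_eq_iff)
qed

text \<open>As many functionals as separate the points of a space bound its dimension. The proof is
  elimination: an \<open>f\<close> nonzero at \<open>q\<close> splits \<open>H\<close> into the
  multiples of \<open>q\<close> and the kernel of \<open>f\<close>, on which the remaining
  functionals still separate.\<close>

lemma spanning_family_of_separating_functionals:
  fixes H :: "('a \<Rightarrow> real) set" and \<phi> :: "(('a \<Rightarrow> real) \<Rightarrow> real) list"
  assumes "(\<lambda>x. 0) \<in> H" and "\<And>p q c. p \<in> H \<Longrightarrow> q \<in> H \<Longrightarrow> (\<lambda>x. p x + c * q x) \<in> H"
    and "\<And>f p q c. f \<in> set \<phi> \<Longrightarrow> p \<in> H \<Longrightarrow> q \<in> H \<Longrightarrow> f (\<lambda>x. p x + c * q x) = f p + c * f q"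
    and "\<And>p. p \<in> H \<Longrightarrow> (\<And>f. f \<in> set \<phi> \<Longrightarrow> f p = 0) \<Longrightarrow> p = (\<lambda>x. 0)"
  shows "\<exists>h. (\<forall>i<length \<phi>. h i \<in> H) \<and> (\<forall>p\<in>H. \<exists>c. p = (\<lambda>x. \<Sum>i<length \<phi>. c i * h i x))"
  using assms
proof (induction \<phi> arbitrary: H)
  case Nil
  then show ?case by auto
next
  case (Cons f \<phi>)
  show ?case
  proof (cases "\<forall>p\<in>H. f p = 0")
    case True
    have "\<exists>h. (\<forall>i<length \<phi>. h i \<in> H) \<and> (\<forall>p\<in>H. \<exists>c. p = (\<lambda>x. \<Sum>i<length \<phi>. c i * h i x))"
    proof (rule Cons.IH)
      show "g (\<lambda>x. p x + c * r x) = g p + c * g r" if "g \<in> set \<phi>" "p \<in> H" "r \<in> H" for g p r c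
        using that Cons.prems(3) by simp
      show "p = (\<lambda>x. 0)" if "p \<in> H" "\<And>g. g \<in> set \<phi> \<Longrightarrow> g p = 0" for p
        using that True by (intro Cons.prems(4)) auto
    qed (fact Cons.prems)+
    then obtain h where h: "\<forall>i<length \<phi>. h i \<in> H" "\<forall>p\<in>H. \<exists>c. p = (\<lambda>x. \<Sum>i<length \<phi>. c i * h i x)"
      by blast
    \<comment> \<open>A functional that vanishes on \<open>H\<close> contributes the zero function,
      which keeps the length of the family equal to that of the list.\<close>
    show ?thesis
    proof (intro exI[of _ "h(length \<phi> := (\<lambda>x. 0))"] conjI ballI allI impI)
      show "(h(length \<phi> := (\<lambda>x. 0))) i \<in> H" if "i < length (f # \<phi>)" for i
        using that h(1) Cons.prems(1) by (cases "i = length \<phi>") simp_all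
      fix p assume "p \<in> H"
      then obtain c where "p = (\<lambda>x. \<Sum>i<length \<phi>. c i * h i x)"
        using h(2) by blast
      then have "p = (\<lambda>x. \<Sum>i<length (f # \<phi>). c i * (h(length \<phi> := (\<lambda>x. 0))) i x)"
        by (simp add: fun_eq_iff)
      then show "\<exists>c. p = (\<lambda>x. \<Sum>i<length (f # \<phi>). c i * (h(length \<phi> := (\<lambda>x. 0))) i x)"
        by blast
    qed
  next
    case False
    then obtain q where q: "q \<in> H" "f q \<noteq> 0" by blast
    define H' where "H' = {p \<in> H. f p = 0}"
    have f0: "f (\<lambda>x. 0) = 0"
      using Cons.prems(3)[OF _ q(1) q(1), of f "-1"] by simp
    have "\<exists>h. (\<forall>i<length \<phi>. h i \<in> H') \<and> (\<forall>p\<in>H'. \<exists>c. p = (\<lambda>x. \<Sum>i<length \<phi>. c i * h i x))"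
    proof (rule Cons.IH)
      show "(\<lambda>x. 0) \<in> H'"
        using Cons.prems(1) f0 by (simp add: H'_def)
      show "(\<lambda>x. p x + c * r x) \<in> H'" if "p \<in> H'" "r \<in> H'" for p r c
        using that Cons.prems(2)[of p r c] Cons.prems(3)[of f p r c] by (simp add: H'_def)
      show "g (\<lambda>x. p x + c * r x) = g p + c * g r" if "g \<in> set \<phi>" "p \<in> H'" "r \<in> H'" for g p r c
        using that Cons.prems(3) by (simp add: H'_def)
      show "p = (\<lambda>x. 0)" if "p \<in> H'" "\<And>g. g \<in> set \<phi> \<Longrightarrow> g p = 0" for p
        using that Cons.prems(4)[of p] by (auto simp: H'_def)
    qed
    then obtain h where h: "\<forall>i<length \<phi>. h i \<in> H'" "\<forall>p\<in>H'. \<exists>c. p = (\<lambda>x. \<Sum>i<length \<phi>. c i * h i x)"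
      by blast
    show ?thesis
    proof (intro exI[of _ "h(length \<phi> := q)"] conjI ballI allI impI)
      show "(h(length \<phi> := q)) i \<in> H" if "i < length (f # \<phi>)" for i
        using that h(1) q(1) by (auto simp: less_Suc_eq H'_def)
      fix p assume p: "p \<in> H"
      define a where "a = f p / f q"
      have "(\<lambda>x. p x + (- a) * q x) \<in> H'"
        using Cons.prems(2)[OF p q(1), of "- a"] Cons.prems(3)[OF _ p q(1), of f "- a"] q(2)
        by (simp add: H'_def a_def)
      then obtain c where c: "(\<lambda>x. p x + (- a) * q x) = (\<lambda>x. \<Sum>i<length \<phi>. c i * h i x)"
        using h(2) by blast
      have "p = (\<lambda>x. \<Sum>i<length (f # \<phi>). (c(length \<phi> := a)) i * (h(length \<phi> := q)) i x)"
      proof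
        fix x
        from fun_cong[OF c, of x]
        show "p x = (\<Sum>i<length (f # \<phi>). (c(length \<phi> := a)) i * (h(length \<phi> := q)) i x)"
          by simp
      qed
      then show "\<exists>c. p = (\<lambda>x. \<Sum>i<length (f # \<phi>). c i * (h(length \<phi> := q)) i x)"
        by blast
    qed
  qed
qed

lemma homogeneous_harmonic_polys_linear:
  assumes "p \<in> homogeneous_harmonic_polys l" "q \<in> homogeneous_harmonic_polys l"
  shows "(\<lambda>x. p x + c * q x) \<in> homogeneous_harmonic_polys l"
proof -
  have "real_polynomial_function (\<lambda>x. c * q x)"
    using assms by (intro real_polynomial_function.intros(4)) (auto simp: homogeneous_harmonic_polys_iff)
  with assms show ?thesis
    by (auto simp: homogeneous_harmonic_polys_iff lap_add lap_cmult homogeneous_def distrib_left)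
qed

text \<open>The right-hand side counts the sorted words of length \<open>l\<close> without the
  distinguished letter, plus those containing it once. It agrees with the difference of binomials by
  Pascal's rule applied twice.\<close>

lemma harmonic_dim_eq:
  assumes "2 \<le> d"
  shows "harmonic_dim d l = ((d - 1) + l - 1 choose l) + (if l = 0 then 0 else ((d - 1) + (l - 1) - 1 choose (l - 1)))"
proof -
  obtain e where d: "d = e + 2"
    using assms by (metis add.commute le_Suc_ex)
  consider "l = 0" | "l = 1" | k where "l = k + 2"
    by (metis One_nat_def Suc_1 add.commute le_Suc_ex less_2_cases not_less)
  then show ?thesis
    by cases (simp_all add: harmonic_dim_def d)
qed

text \<open>By harmonicity, second derivatives along one basis vector \<open>e\<close> can be traded for derivatives along
  the other ones; so the derivatives of order \<open>l\<close> that involve \<open>e\<close> at most once separate the space.\<close>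

lemma homogeneous_harmonic_polys_spanning_family:
  assumes d: "2 \<le> DIM('a::euclidean_space)"
  shows "\<exists>h :: nat \<Rightarrow> 'a \<Rightarrow> real. (\<forall>i<harmonic_dim DIM('a) l. h i \<in> homogeneous_harmonic_polys l) \<and>
    (\<forall>p\<in>homogeneous_harmonic_polys l. \<exists>c. p = (\<lambda>x. \<Sum>i<harmonic_dim DIM('a) l. c i * h i x))"
proof -
  obtain es :: "'a list" where es: "set es = Basis" "distinct es"
    using finite_distinct_list[OF finite_Basis] by blast
  then have len: "length es = DIM('a)"
    using distinct_card by fastforce
  with d obtain e bs where ebs: "es = e # bs"
    by (cases es) auto
  define W where "W = sorted_words bs l @ (if l = 0 then [] else map ((#) e) (sorted_words bs (l - 1)))"
  define \<phi> where "\<phi> = map (\<lambda>w p. word_deriv w p (0::'a)) W"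
  have "length bs = DIM('a) - 1"
    using len by (simp add: ebs)
  then have "length \<phi> = harmonic_dim DIM('a) l"
    unfolding harmonic_dim_eq[OF d] by (simp add: \<phi>_def W_def length_sorted_words)
  moreover have "\<exists>h :: nat \<Rightarrow> 'a \<Rightarrow> real. (\<forall>i<length \<phi>. h i \<in> homogeneous_harmonic_polys l) \<and>
    (\<forall>p\<in>homogeneous_harmonic_polys l. \<exists>c. p = (\<lambda>x. \<Sum>i<length \<phi>. c i * h i x))"
  proof (rule spanning_family_of_separating_functionals)
    show "(\<lambda>x::'a. 0) \<in> homogeneous_harmonic_polys l"
      by (auto simp: homogeneous_harmonic_polys_iff homogeneous_def)
    show "f (\<lambda>x. p x + c * q x) = f p + c * f q"
      if "f \<in> set \<phi>" "p \<in> homogeneous_harmonic_polys l" "q \<in> homogeneous_harmonic_polys l" for f p q c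
      using that by (auto simp: \<phi>_def homogeneous_harmonic_polys_iff word_deriv_linear)
    show "p = (\<lambda>x. 0)"
      if p: "p \<in> homogeneous_harmonic_polys l" and 0: "\<And>f. f \<in> set \<phi> \<Longrightarrow> f p = 0" for p
    proof (rule homogeneous_eq_0)
      show poly: "real_polynomial_function p" and "homogeneous l p"
        using p by (simp_all add: homogeneous_harmonic_polys_iff)
      have harm: "lap p = (\<lambda>x. 0)"
        using p by (simp add: homogeneous_harmonic_polys_iff)
      have W0: "word_deriv w p 0 = 0" if "w \<in> set W" for w
        using 0[of "\<lambda>p. word_deriv w p 0"] that by (simp add: \<phi>_def)
      fix w :: "'a list" assume w: "set w \<subseteq> Basis" "length w = l"
      show "word_deriv w p 0 = 0"
      proof (rule harmonic_word_deriv_eq_0[OF poly harm _ _ _ _ w])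
        show "set (e # bs) = Basis" "distinct (e # bs)"
          using es unfolding ebs by blast+
        show "word_deriv v p 0 = 0" if "v \<in> set (sorted_words bs l)" for v
          by (rule W0) (simp add: W_def that)
        show "word_deriv (e # v) p 0 = 0" if "l \<noteq> 0" "v \<in> set (sorted_words bs (l - 1))" for v
          using that by (intro W0) (auto simp: W_def)
      qed
    qed
  qed (rule homogeneous_harmonic_polys_linear)
  ultimately show ?thesis by simp
qed

section \<open>Tchakaloff's theorem\<close>

text \<open>Gaussian elimination: equation \<open>i0\<close> removes the unknown \<open>j0\<close>
  from the other equations, leaving one equation and one unknown fewer.\<close>

lemma underdetermined_system_nontrivial:
  fixes a :: "'i \<Rightarrow> 'j \<Rightarrow> real"
  assumes "finite I" "finite J" "card I < card J"
  shows "\<exists>c. (\<exists>j\<in>J. c j \<noteq> 0) \<and> (\<forall>i\<in>I. (\<Sum>j\<in>J. c j * a i j) = 0)"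
  using assms
proof (induction I arbitrary: J a rule: finite_induct)
  case empty
  then have "J \<noteq> {}" by auto
  then show ?case by (auto intro: exI[of _ "\<lambda>_. 1"])
next
  case (insert i0 I)
  show ?case
  proof (cases "\<forall>j\<in>J. a i0 j = 0")
    case True
    moreover obtain c where "\<exists>j\<in>J. c j \<noteq> 0" "\<forall>i\<in>I. (\<Sum>j\<in>J. c j * a i j) = 0"
      using insert.IH[of J a] insert.prems insert.hyps by auto
    ultimately show ?thesis by auto
  next
    case False
    then obtain j0 where j0: "j0 \<in> J" "a i0 j0 \<noteq> 0" by blast
    define J' where "J' = J - {j0}"
    have J: "finite J'" "J = insert j0 J'" "j0 \<notin> J'"
      using j0 insert.prems by (auto simp: J'_def)
    have "card I < card J'"
      using insert.prems insert.hyps J by simp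
    then obtain c where c: "\<exists>j\<in>J'. c j \<noteq> 0"
      "\<forall>i\<in>I. (\<Sum>j\<in>J'. c j * (a i j - a i j0 / a i0 j0 * a i0 j)) = 0"
      using insert.IH[of J' "\<lambda>i j. a i j - a i j0 / a i0 j0 * a i0 j"] J(1) by blast
    define S where "S = (\<Sum>j\<in>J'. c j * a i0 j)"
    \<comment> \<open>Back substitution: the value at \<open>j0\<close> is the one that satisfies
      equation \<open>i0\<close>.\<close>
    define c' where "c' = c(j0 := - S / a i0 j0)"
    have sum: "(\<Sum>j\<in>J. c' j * a i j) = - S / a i0 j0 * a i j0 + (\<Sum>j\<in>J'. c j * a i j)" for i
    proof -
      have "(\<Sum>j\<in>J'. c' j * a i j) = (\<Sum>j\<in>J'. c j * a i j)"
        using J(3) by (intro sum.cong) (auto simp: c'_def)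
      with J show ?thesis by (simp add: c'_def)
    qed
    have "(\<Sum>j\<in>J. c' j * a i j) = 0" if "i \<in> insert i0 I" for i
    proof (cases "i = i0")
      case True
      then show ?thesis using j0(2) by (simp add: sum S_def[symmetric])
    next
      case False
      with that have "(\<Sum>j\<in>J'. c j * (a i j - a i j0 / a i0 j0 * a i0 j)) = 0"
        using c(2) by blast
      then have "(\<Sum>j\<in>J'. c j * a i j) - a i j0 / a i0 j0 * S = 0"
        by (simp add: S_def sum_distrib_left right_diff_distrib sum_subtractf mult_ac)
      then show ?thesis
        by (simp add: sum)
    qed
    moreover have "\<exists>j\<in>J. c' j \<noteq> 0"
      using c(1) J by (auto simp: c'_def)
    ultimately show ?thesis by blast
  qed
qed

text \<open>The conic form of Caratheodory's theorem. Among the admissible weights one with smallest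
  support is taken; were its support larger than \<open>card I\<close>, a linear relation on the
  support could be subtracted until another weight reaches 0.\<close>

lemma caratheodory_weights:
  fixes a :: "'i \<Rightarrow> 'j \<Rightarrow> real"
  assumes I: "finite I" and J: "finite J" and w: "\<And>j. j \<in> J \<Longrightarrow> 0 \<le> w j"
  obtains v where "\<And>j. j \<in> J \<Longrightarrow> 0 \<le> v j" "card {j\<in>J. v j \<noteq> 0} \<le> card I"
    "\<And>i. i \<in> I \<Longrightarrow> (\<Sum>j\<in>J. v j * a i j) = (\<Sum>j\<in>J. w j * a i j)"
proof -
  define F where "F v \<longleftrightarrow> (\<forall>j\<in>J. 0 \<le> v j) \<and> (\<forall>i\<in>I. (\<Sum>j\<in>J. v j * a i j) = (\<Sum>j\<in>J. w j * a i j))" for v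
  have "F w"
    using w by (simp add: F_def)
  then obtain v where v: "F v" and least: "\<And>u. F u \<Longrightarrow> card {j\<in>J. v j \<noteq> 0} \<le> card {j\<in>J. u j \<noteq> 0}"
    using ex_has_least_nat[of F w "\<lambda>v. card {j\<in>J. v j \<noteq> 0}"] by blast
  define T where "T = {j\<in>J. v j \<noteq> 0}"
  have T: "finite T" "T \<subseteq> J"
    using J by (auto simp: T_def)
  have "card T \<le> card I"
  proof (rule ccontr)
    assume "\<not> card T \<le> card I"
    then obtain c0 where c0: "\<exists>j\<in>T. c0 j \<noteq> 0" "\<forall>i\<in>I. (\<Sum>j\<in>T. c0 j * a i j) = 0"
      using underdetermined_system_nontrivial[OF I T(1), of a] by auto
    \<comment> \<open>The sign is chosen so that some coefficient is positive; otherwise no weight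
      would decrease along the relation.\<close>
    obtain s where s: "\<exists>j\<in>T. 0 < s * c0 j"
    proof -
      obtain j where "j \<in> T" "c0 j \<noteq> 0" using c0 by blast
      then have "\<exists>j\<in>T. 0 < c0 j * c0 j"
        by (auto simp: zero_less_mult_iff linorder_neq_iff)
      then show thesis using that by blast
    qed
    define c where "c j = (if j \<in> T then s * c0 j else 0)" for j
    define P where "P = {j\<in>T. 0 < c j}"
    \<comment> \<open>The largest step that keeps all weights nonnegative; the index attaining the
      minimum drops out of the support.\<close>
    define t where "t = Min ((\<lambda>j. v j / c j) ` P)"
    have P: "finite P" "P \<noteq> {}"
      using T(1) s by (auto simp: P_def c_def)
    have t_le: "t \<le> v j / c j" if "j \<in> P" for j
      using that P by (simp add: t_def)
    have "t \<in> (\<lambda>j. v j / c j) ` P"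
      unfolding t_def using P by (intro Min_in) auto
    then obtain k where k: "k \<in> P" "t = v k / c k" by blast
    have vpos: "0 < v j" if "j \<in> T" for j
      using that v by (force simp: T_def F_def order_less_le)
    have t0: "0 \<le> t"
      using k vpos[of k] by (auto simp: P_def)
    define u where "u j = v j - t * c j" for j
    have "F u"
      unfolding F_def
    proof (intro conjI ballI)
      fix j assume j: "j \<in> J"
      show "0 \<le> u j"
      proof (cases "j \<in> P")
        case True
        with t_le[OF True] show ?thesis
          by (simp add: u_def P_def pos_le_divide_eq)
      next
        case False
        then have "c j \<le> 0"
          by (auto simp: P_def c_def)
        with t0 have "t * c j \<le> 0"
          by (simp add: mult_nonneg_nonpos)
        moreover have "0 \<le> v j"
          using v j by (simp add: F_def)
        ultimately show ?thesis by (simp add: u_def)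
      qed
    next
      fix i assume i: "i \<in> I"
      have "(\<Sum>j\<in>J. c j * a i j) = (\<Sum>j\<in>T. c j * a i j)"
        using J T by (intro sum.mono_neutral_right) (auto simp: c_def)
      also have "\<dots> = s * (\<Sum>j\<in>T. c0 j * a i j)"
        by (simp add: c_def sum_distrib_left mult.assoc)
      finally have "(\<Sum>j\<in>J. c j * a i j) = 0"
        using c0 i by simp
      moreover have "(\<Sum>j\<in>J. u j * a i j) = (\<Sum>j\<in>J. v j * a i j) - t * (\<Sum>j\<in>J. c j * a i j)"
        by (simp add: u_def left_diff_distrib sum_subtractf sum_distrib_left mult.assoc)
      ultimately show "(\<Sum>j\<in>J. u j * a i j) = (\<Sum>j\<in>J. w j * a i j)"
        using v i by (simp add: F_def)
    qed
    moreover have "{j\<in>J. u j \<noteq> 0} \<subset> T"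
    proof
      show "{j\<in>J. u j \<noteq> 0} \<subseteq> T"
        by (auto simp: u_def T_def c_def split: if_splits)
      have "u k = 0" "k \<in> T"
        using k by (auto simp: u_def P_def)
      then show "{j\<in>J. u j \<noteq> 0} \<noteq> T" by blast
    qed
    then have "card {j\<in>J. u j \<noteq> 0} < card T"
      using T(1) by (intro psubset_card_mono)
    ultimately show False
      using least[of u] by (simp add: T_def)
  qed
  with v show thesis
    by (intro that[of v]) (auto simp: F_def T_def)
qed

lemma common_convergent_subsequence:
  fixes z :: "nat \<Rightarrow> nat \<Rightarrow> 'a::metric_space"
  assumes C: "compact C" and z: "\<And>n j. j < m \<Longrightarrow> z n j \<in> C"
  shows "\<exists>r l. strict_mono (r :: nat \<Rightarrow> nat) \<and> (\<forall>j<m. l j \<in> C \<and> (\<lambda>n. z (r n) j) \<longlonglongrightarrow> l j)"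
  using z
proof (induction m)
  case 0
  show ?case by (auto intro: exI[of _ id] strict_mono_id)
next
  case (Suc m)
  then obtain r l where r: "strict_mono (r :: nat \<Rightarrow> nat)"
    and l: "\<forall>j<m. l j \<in> C \<and> (\<lambda>n. z (r n) j) \<longlonglongrightarrow> l j" by auto
  have "\<forall>n. z (r n) m \<in> C" using Suc.prems by simp
  then obtain l' s where s: "l' \<in> C" "strict_mono s" "((\<lambda>n. z (r n) m) \<circ> s) \<longlonglongrightarrow> l'"
    using seq_compactE[OF compact_imp_seq_compact[OF C], of "\<lambda>n. z (r n) m"] by metis
  have "(\<lambda>n. z (r (s n)) j) \<longlonglongrightarrow> l j" if "j < m" for j
    using LIMSEQ_subseq_LIMSEQ[OF _ s(2), of "\<lambda>n. z (r n) j"] l that by (simp add: o_def)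
  then show ?case
    using l s strict_mono_o[OF r s(2)]
    by (intro exI[of _ "r \<circ> s"] exI[of _ "l(m := l')"]) (auto simp: less_Suc_eq o_def)
qed

section \<open>Quadrature on the sphere with a bounded number of nodes\<close>

context uniform_sphere
begin

text \<open>A Riemann sum: the sphere is cut into small pieces on which every \<open>f i\<close>
  varies by less than \<open>e\<close>, and each node carries the measure of its piece. The number
  \<open>k\<close> of nodes is not controlled here and may grow as \<open>e\<close> shrinks.\<close>

lemma discrete_approximation:
  fixes f :: "'i \<Rightarrow> 'a \<Rightarrow> real"
  assumes I: "finite I" and f: "\<And>i. i \<in> I \<Longrightarrow> continuous_on unit_sphere (f i)" and e: "0 < e"
  shows "\<exists>(k::nat) w c. (\<forall>j<k. c j \<in> unit_sphere \<and> 0 \<le> w j) \<and>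
    (\<forall>i\<in>I. \<bar>(\<Sum>j<k. w j * f i (c j)) - (LINT x|\<sigma>. f i x)\<bar> \<le> e)"
proof -
  have "\<exists>d>0. \<forall>x\<in>unit_sphere. \<forall>y\<in>unit_sphere. dist y x < d \<longrightarrow> dist (f i y) (f i x) < e"
    if "i \<in> I" for i
    using compact_uniformly_continuous[OF f[OF that] compact_sphere] e
    unfolding uniformly_continuous_on_def by blast
  then obtain D where D: "\<And>i. i \<in> I \<Longrightarrow> 0 < D i"
    "\<And>i x y. i \<in> I \<Longrightarrow> x \<in> unit_sphere \<Longrightarrow> y \<in> unit_sphere \<Longrightarrow> dist y x < D i \<Longrightarrow> dist (f i y) (f i x) < e"
    by metis
  \<comment> \<open>The element 1 keeps the minimum meaningful when \<open>I\<close> is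
    empty.\<close>
  define d where "d = Min (insert 1 (D ` I))"
  have d: "0 < d" "\<And>i. i \<in> I \<Longrightarrow> d \<le> D i"
    using I D(1) by (auto simp: d_def)
  obtain C where C: "finite C" "C \<subseteq> unit_sphere" "(unit_sphere :: 'a set) \<subseteq> (\<Union>x\<in>C. ball x d)"
  proof (rule compactE_image[OF compact_sphere[of "0::'a" 1], of unit_sphere "\<lambda>x. ball x d"])
    show "(unit_sphere :: 'a set) \<subseteq> (\<Union>x\<in>unit_sphere. ball x d)"
      using d(1) by force
  qed (use that in auto)
  obtain c :: "nat \<Rightarrow> 'a" and k where c: "C = c ` {..<k}"
    using finite_imp_nat_seg_image_inj_on[OF C(1)] by (auto simp: lessThan_def)
  define A where "A n = (if n < k then ball (c n) d \<inter> unit_sphere else {})" for n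
  define B where "B = disjointed A"
  define w where "w n = (LINT x|\<sigma>. indicator (B n) x :: real)" for n
  have "A n \<in> sets \<sigma>" for n
    by (auto simp: A_def sets_eq sets_restrict_space)
  then have B: "B n \<in> sets \<sigma>" for n
    unfolding B_def using sets.range_disjointed_sets[of A \<sigma>] by blast
  have intB: "integrable \<sigma> (\<lambda>x. indicator (B n) x * h x)" if "continuous_on unit_sphere h"
    for n and h :: "'a \<Rightarrow> real"
    using integrable_mult_indicator[OF B integrable_continuous[OF that]] by simp
  have one: "(\<Sum>n<k. indicator (B n) x) = (1::real)" if "x \<in> unit_sphere" for x
  proof -
    have "x \<in> (\<Union>n. B n)"
      unfolding B_def UN_disjointed_eq using subsetD[OF C(3) that] that by (auto simp: A_def c)
    then obtain n where n: "x \<in> B n" by blast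
    have "n < k"
      using n disjointed_subset[of A n] by (auto simp: B_def A_def split: if_splits)
    moreover have "x \<notin> B j" if "j \<noteq> n" for j
      using n that disjoint_family_disjointed[of A] by (auto simp: B_def disjoint_family_on_def)
    ultimately have "(\<Sum>j<k. indicator (B j) x) = (\<Sum>j\<in>{n}. indicator (B j) x :: real)"
      by (intro sum.mono_neutral_right) auto
    with n show ?thesis by simp
  qed
  have "\<bar>(\<Sum>j<k. w j * f i (c j)) - (LINT x|\<sigma>. f i x)\<bar> \<le> e" if i: "i \<in> I" for i
  proof -
    have "(LINT x|\<sigma>. f i x) = (LINT x|\<sigma>. (\<Sum>j<k. indicator (B j) x * f i x))"
      using one by (intro integral_sphere_cong) (simp flip: sum_distrib_right)
    also have "\<dots> = (\<Sum>j<k. LINT x|\<sigma>. indicator (B j) x * f i x)"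
      by (rule Bochner_Integration.integral_sum) (rule intB[OF f[OF i]])
    finally have "(\<Sum>j<k. w j * f i (c j)) - (LINT x|\<sigma>. f i x)
      = (\<Sum>j<k. (LINT x|\<sigma>. indicator (B j) x * f i (c j)) - (LINT x|\<sigma>. indicator (B j) x * f i x))"
      by (simp add: w_def sum_subtractf)
    also have "\<dots> = (\<Sum>j<k. LINT x|\<sigma>. indicator (B j) x * (f i (c j) - f i x))"
      using intB[OF f[OF i]] intB[OF continuous_on_const]
      by (simp add: right_diff_distrib del: integral_mult_left)
    also have "\<bar>\<dots>\<bar> \<le> (\<Sum>j<k. \<bar>LINT x|\<sigma>. indicator (B j) x * (f i (c j) - f i x)\<bar>)"
      by (rule sum_abs)
    also have "\<dots> \<le> (\<Sum>j<k. LINT x|\<sigma>. indicator (B j) x * e)"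
    proof (rule sum_mono)
      fix j assume j: "j \<in> {..<k}"
      have int: "integrable \<sigma> (\<lambda>x. indicator (B j) x * (f i (c j) - f i x))"
        using f[OF i] by (intro intB continuous_intros)
      have "\<bar>LINT x|\<sigma>. indicator (B j) x * (f i (c j) - f i x)\<bar>
          \<le> (LINT x|\<sigma>. \<bar>indicator (B j) x * (f i (c j) - f i x)\<bar>)"
        by (rule integral_abs_bound)
      also have "\<dots> \<le> (LINT x|\<sigma>. indicator (B j) x * e)"
      proof (rule integral_mono)
        fix x assume "x \<in> space \<sigma>"
        then have x: "x \<in> unit_sphere" by (simp add: space_eq)
        show "\<bar>indicator (B j) x * (f i (c j) - f i x)\<bar> \<le> indicator (B j) x * e"
        proof (cases "x \<in> B j")
          case True
          then have "x \<in> A j"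
            using disjointed_subset[of A j] by (auto simp: B_def)
          then have "dist (c j) x < D i"
            using j d(2)[OF i] by (auto simp: A_def)
          then have "dist (f i (c j)) (f i x) < e"
            using j C(2) c by (intro D(2)[OF i x]) auto
          with True show ?thesis by (simp add: dist_real_def)
        qed simp
      qed (use int intB[OF continuous_on_const] in auto)
      finally show "\<bar>LINT x|\<sigma>. indicator (B j) x * (f i (c j) - f i x)\<bar> \<le> (LINT x|\<sigma>. indicator (B j) x * e)" .
    qed
    also have "\<dots> = (LINT x|\<sigma>. (\<Sum>j<k. indicator (B j) x * e))"
      by (rule Bochner_Integration.integral_sum[symmetric]) (rule intB[OF continuous_on_const])
    also have "\<dots> = (LINT x|\<sigma>. e)"
      using one by (intro integral_sphere_cong) (simp flip: sum_distrib_right)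
    finally show ?thesis by simp
  qed
  moreover have "\<forall>j<k. c j \<in> unit_sphere \<and> 0 \<le> w j"
    using C(2) c by (auto simp: w_def)
  ultimately show ?thesis by blast
qed

text \<open>The bound on the number of nodes no longer depends on \<open>e\<close>, so nodes and
  weights for different \<open>e\<close> live in one fixed finite product and a limit can be
  taken.\<close>

lemma discrete_approximation_bounded_card:
  fixes f :: "'i \<Rightarrow> 'a \<Rightarrow> real"
  assumes I: "finite I" and f: "\<And>i. i \<in> I \<Longrightarrow> continuous_on unit_sphere (f i)" and e: "0 < e"
  shows "\<exists>w c. (\<forall>j<card I. c j \<in> unit_sphere \<and> 0 \<le> w j) \<and>
    (\<forall>i\<in>I. \<bar>(\<Sum>j<card I. w j * f i (c j)) - (LINT x|\<sigma>. f i x)\<bar> \<le> e)"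
proof -
  obtain k :: nat and w c where k: "\<forall>j<k. c j \<in> unit_sphere \<and> 0 \<le> w j"
    "\<forall>i\<in>I. \<bar>(\<Sum>j<k. w j * f i (c j)) - (LINT x|\<sigma>. f i x)\<bar> \<le> e"
    using discrete_approximation[where f = f, OF I f e] by blast
  obtain v where v: "\<And>j. j \<in> {..<k} \<Longrightarrow> 0 \<le> v j" "card {j\<in>{..<k}. v j \<noteq> 0} \<le> card I"
    "\<And>i. i \<in> I \<Longrightarrow> (\<Sum>j<k. v j * f i (c j)) = (\<Sum>j<k. w j * f i (c j))"
    using caratheodory_weights[OF I finite_lessThan[of k], of w "\<lambda>i j. f i (c j)"] k(1) by blast
  define T where "T = {j\<in>{..<k}. v j \<noteq> 0}"
  have T: "finite T" "T \<subseteq> {..<k}" by (auto simp: T_def)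
  obtain h where h: "bij_betw h {..<card T} T"
    using ex_bij_betw_nat_finite[OF T(1)] by (auto simp: atLeast0LessThan)
  obtain x0 :: 'a where x0: "x0 \<in> unit_sphere"
    using vector_choose_size[of 1] by auto
  \<comment> \<open>Padding with zero weights at an arbitrary point \<open>x0\<close> makes the
    number of nodes exactly \<open>card I\<close> for every \<open>e\<close>.\<close>
  define v' where "v' j = (if j < card T then v (h j) else 0)" for j
  define c' where "c' j = (if j < card T then c (h j) else x0)" for j
  have hT: "h j \<in> T" if "j < card T" for j
    using h that by (auto simp: bij_betw_def)
  have "\<forall>j<card I. c' j \<in> unit_sphere \<and> 0 \<le> v' j"
  proof (intro allI impI conjI)
    fix j
    have "h j < k" if "j < card T"
      using hT[OF that] T(2) by auto
    then show "c' j \<in> unit_sphere" "0 \<le> v' j"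
      using k(1) v(1) x0 by (auto simp: c'_def v'_def)
  qed
  moreover have "(\<Sum>j<card I. v' j * f i (c' j)) = (\<Sum>j<k. v j * f i (c j))" for i
  proof -
    have "(\<Sum>j<card I. v' j * f i (c' j)) = (\<Sum>j<card T. v' j * f i (c' j))"
      using v(2) by (intro sum.mono_neutral_right) (auto simp: v'_def T_def)
    also have "\<dots> = (\<Sum>j<card T. v (h j) * f i (c (h j)))"
      by (simp add: v'_def c'_def)
    also have "\<dots> = (\<Sum>j\<in>T. v j * f i (c j))"
      using sum.reindex_bij_betw[OF h] .
    also have "\<dots> = (\<Sum>j<k. v j * f i (c j))"
      by (intro sum.mono_neutral_left) (auto simp: T_def)
    finally show ?thesis .
  qed
  ultimately show ?thesis
    using k(2) v(3) by (intro exI[of _ v'] exI[of _ c']) auto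
qed

text \<open>The weights and nodes of ever better discrete approximations with a bounded number of atoms vary
  in a compact set.\<close>

lemma tchakaloff:
  fixes f :: "'i \<Rightarrow> 'a \<Rightarrow> real"
  assumes I: "finite I" and f: "\<And>i. i \<in> I \<Longrightarrow> continuous_on unit_sphere (f i)"
  shows "\<exists>N w x. (\<forall>j\<in>{1..N}. x j \<in> unit_sphere \<and> 0 < w j) \<and> (\<Sum>j=1..N. w j) = 1 \<and>
    (\<forall>i\<in>I. (\<Sum>j=1..N. w j * f i (x j)) = (LINT x|\<sigma>. f i x)) \<and> N \<le> card I + 1"
proof -
  \<comment> \<open>The index \<open>None\<close> adds the constant function 1. Its moment is the
    total mass; it accounts for the extra atom.\<close>
  define g where "g = case_option (\<lambda>_. 1) f"
  define I' where "I' = insert None (Some ` I)"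
  define m where "m = card I'"
  have I': "finite I'" "m = card I + 1"
    using I by (auto simp: I'_def m_def card_image)
  have g: "continuous_on unit_sphere (g i)" if "i \<in> I'" for i
    using that f by (auto simp: g_def I'_def)
  have "\<exists>w c. (\<forall>j<m. c j \<in> unit_sphere \<and> 0 \<le> w j) \<and>
    (\<forall>i\<in>I'. \<bar>(\<Sum>j<m. w j * g i (c j)) - (LINT x|\<sigma>. g i x)\<bar> \<le> 1 / real (Suc n))" for n
    unfolding m_def by (rule discrete_approximation_bounded_card[OF I'(1) g]) auto
  then obtain W Y where WY: "\<And>n j. j < m \<Longrightarrow> Y n j \<in> unit_sphere \<and> 0 \<le> W n j"
    "\<And>n i. i \<in> I' \<Longrightarrow> \<bar>(\<Sum>j<m. W n j * g i (Y n j)) - (LINT x|\<sigma>. g i x)\<bar> \<le> 1 / real (Suc n)"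
    by metis
  define z where "z n j = (W n j, Y n j)" for n j
  \<comment> \<open>The approximate total mass is at most \<open>1 + 1 / real (Suc n)\<close>, and
    the weights are nonnegative, so no single weight exceeds 2.\<close>
  have "z n j \<in> {0..2} \<times> unit_sphere" if "j < m" for n j
  proof -
    have "W n j \<le> (\<Sum>j<m. W n j)"
      using WY(1) that by (intro member_le_sum) auto
    also have "\<dots> \<le> 1 + 1 / real (Suc n)"
      using WY(2)[of None n] by (simp add: g_def I'_def)
    also have "\<dots> \<le> 2" by simp
    finally show ?thesis using WY(1)[OF that] by (simp add: z_def)
  qed
  then have "\<exists>r l. strict_mono (r :: nat \<Rightarrow> nat) \<and>
      (\<forall>j<m. l j \<in> {0..2} \<times> unit_sphere \<and> (\<lambda>n. z (r n) j) \<longlonglongrightarrow> l j)"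
    by (intro common_convergent_subsequence compact_Times compact_sphere) auto
  then obtain r l where r: "strict_mono (r :: nat \<Rightarrow> nat)"
    and l: "\<And>j. j < m \<Longrightarrow> l j \<in> {0..2} \<times> unit_sphere" "\<And>j. j < m \<Longrightarrow> (\<lambda>n. z (r n) j) \<longlonglongrightarrow> l j"
    by blast
  have exact: "(\<Sum>j<m. fst (l j) * g i (snd (l j))) = (LINT x|\<sigma>. g i x)" if i: "i \<in> I'" for i
  proof -
    have lim: "(\<lambda>n. W (r n) j * g i (Y (r n) j)) \<longlonglongrightarrow> fst (l j) * g i (snd (l j))" if j: "j < m" for j
    proof (intro tendsto_mult)
      show "(\<lambda>n. W (r n) j) \<longlonglongrightarrow> fst (l j)"
        using tendsto_fst[OF l(2)[OF j]] by (simp add: z_def)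
      have "(\<lambda>n. Y (r n) j) \<longlonglongrightarrow> snd (l j)"
        using tendsto_snd[OF l(2)[OF j]] by (simp add: z_def)
      then show "(\<lambda>n. g i (Y (r n) j)) \<longlonglongrightarrow> g i (snd (l j))"
        using l(1)[OF j] WY(1)[OF j]
        by (intro continuous_on_tendsto_compose[OF g[OF i]]) (auto simp: mem_Times_iff)
    qed
    have "(\<lambda>n. \<Sum>j<m. W (r n) j * g i (Y (r n) j)) \<longlonglongrightarrow> (\<Sum>j<m. fst (l j) * g i (snd (l j)))"
      using lim by (intro tendsto_sum) simp
    moreover have "(\<lambda>n. \<Sum>j<m. W (r n) j * g i (Y (r n) j)) \<longlonglongrightarrow> (LINT x|\<sigma>. g i x)"
    proof (rule LIM_zero_cancel, rule Lim_null_comparison)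
      show "\<forall>\<^sub>F n in sequentially. norm ((\<Sum>j<m. W (r n) j * g i (Y (r n) j)) - (LINT x|\<sigma>. g i x))
          \<le> 1 / real (Suc (r n))"
        using WY(2)[OF i] by simp
      show "(\<lambda>n. 1 / real (Suc (r n))) \<longlonglongrightarrow> 0"
        using LIMSEQ_subseq_LIMSEQ[OF LIMSEQ_inverse_real_of_nat r] by (simp add: o_def inverse_eq_divide)
    qed
    ultimately show ?thesis by (rule LIMSEQ_unique)
  qed
  \<comment> \<open>Weights may tend to 0; discarding these indices restores strict positivity and
    leaves every moment unchanged.\<close>
  define J where "J = {j\<in>{..<m}. fst (l j) \<noteq> 0}"
  obtain h where h: "bij_betw h {1..card J} J"
    using ex_bij_betw_nat_finite_1[of J] by (auto simp: J_def)
  have hJ: "h j \<in> J" if "j \<in> {1..card J}" for j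
    using h that by (auto simp: bij_betw_def)
  have sum: "(\<Sum>j=1..card J. fst (l (h j)) * g i (snd (l (h j)))) = (LINT x|\<sigma>. g i x)" if "i \<in> I'" for i
  proof -
    have "(\<Sum>j=1..card J. fst (l (h j)) * g i (snd (l (h j)))) = (\<Sum>j\<in>J. fst (l j) * g i (snd (l j)))"
      using sum.reindex_bij_betw[OF h] .
    also have "\<dots> = (\<Sum>j<m. fst (l j) * g i (snd (l j)))"
      by (intro sum.mono_neutral_left) (auto simp: J_def)
    finally show ?thesis
      using exact[OF that] by simp
  qed
  show ?thesis
  proof (intro exI conjI ballI)
    fix j assume "j \<in> {1..card J}"
    from hJ[OF this] show "snd (l (h j)) \<in> unit_sphere" "0 < fst (l (h j))"
      using l(1)[of "h j"] by (auto simp: J_def mem_Times_iff)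
  next
    show "(\<Sum>j=1..card J. fst (l (h j))) = 1"
      using sum[of None] by (simp add: g_def I'_def)
    show "(\<Sum>j=1..card J. fst (l (h j)) * f i (snd (l (h j)))) = (LINT x|\<sigma>. f i x)" if "i \<in> I" for i
      using sum[of "Some i"] that by (simp add: g_def I'_def)
    show "card J \<le> card I + 1"
      using card_mono[of "{..<m}" J] I'(2) by (auto simp: J_def)
  qed
qed

end

section \<open>Finiteness of surface area measures\<close>

lemma hausdorff_premeasure_le:
  fixes A :: "'a::metric_space set" and U :: "'j \<Rightarrow> 'a set"
  assumes J: "finite J" and cover: "A \<subseteq> (\<Union>j\<in>J. U j)"
    and U: "\<And>j. j \<in> J \<Longrightarrow> bounded (U j)" "\<And>j. j \<in> J \<Longrightarrow> diameter (U j) \<le> \<epsilon>"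
    and \<epsilon>: "0 \<le> \<epsilon>" "\<epsilon> \<le> \<delta>"
  shows "hausdorff_premeasure m \<delta> A \<le> ennreal (card J * (unit_ball_vol m * (\<epsilon> / 2) ^ m))"
proof -
  obtain h where h: "bij_betw h {..<card J} J"
    using ex_bij_betw_nat_finite[OF J] by (auto simp: atLeast0LessThan)
  \<comment> \<open>Padding the finite cover with empty sets costs nothing, as the premeasure
    charges 0 for them even when \<open>m = 0\<close>.\<close>
  define V where "V i = (if i < card J then U (h i) else {})" for i
  have hJ: "h i \<in> J" if "i < card J" for i
    using h that by (auto simp: bij_betw_def)
  have "A \<subseteq> (\<Union>i. V i)"
  proof
    fix x assume "x \<in> A"
    then obtain j where j: "j \<in> J" "x \<in> U j" using cover by blast
    then have "j \<in> h ` {..<card J}"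
      using h by (simp add: bij_betw_def)
    then obtain i where "i < card J" "h i = j"
      by blast
    with j show "x \<in> (\<Union>i. V i)"
      by (auto simp: V_def intro!: exI[of _ i])
  qed
  moreover have "bounded (V i) \<and> diameter (V i) \<le> \<delta>" for i
    using U[OF hJ] \<epsilon> by (auto simp: V_def intro: order_trans)
  ultimately have "hausdorff_premeasure m \<delta> A \<le>
      (\<Sum>i. if V i = {} then 0 else ennreal (unit_ball_vol (real m) * (diameter (V i) / 2) ^ m))"
    unfolding hausdorff_premeasure_def by (intro INF_lower) auto
  also have "\<dots> = (\<Sum>i<card J. if V i = {} then 0 else ennreal (unit_ball_vol (real m) * (diameter (V i) / 2) ^ m))"
    by (rule suminf_finite) (auto simp: V_def)
  also have "\<dots> \<le> (\<Sum>i<card J. ennreal (unit_ball_vol m * (\<epsilon> / 2) ^ m))"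
  proof (rule sum_mono)
    fix i assume "i \<in> {..<card J}"
    then have "bounded (V i)" "diameter (V i) \<le> \<epsilon>"
      using U[OF hJ] by (auto simp: V_def)
    then have "unit_ball_vol (real m) * (diameter (V i) / 2) ^ m \<le> unit_ball_vol m * (\<epsilon> / 2) ^ m"
      by (intro mult_left_mono power_mono divide_right_mono) (auto simp: diameter_ge_0)
    then show "(if V i = {} then 0 else ennreal (unit_ball_vol (real m) * (diameter (V i) / 2) ^ m))
        \<le> ennreal (unit_ball_vol m * (\<epsilon> / 2) ^ m)"
      by (auto intro: ennreal_leI)
  qed
  also have "\<dots> = ennreal (card J * (unit_ball_vol m * (\<epsilon> / 2) ^ m))"
    by (simp add: ennreal_mult' ennreal_of_nat_eq_real_of_nat)
  finally show ?thesis .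
qed

section \<open>A grid on the boundary of a cube\<close>

lemma unit_subinterval:
  fixes y :: real
  assumes "0 \<le> y" "y \<le> real n" "0 < n"
  shows "\<exists>k<n. real k \<le> y \<and> y \<le> real k + 1"
  using assms
proof (induction n)
  case (Suc n)
  show ?case
  proof (cases "y \<le> real n \<and> 0 < n")
    case True
    with Suc show ?thesis by (auto intro: less_SucI)
  next
    case False
    with Suc.prems have "real n \<le> y \<and> y \<le> real n + 1" by auto
    then show ?thesis by blast
  qed
qed simp

text \<open>A cell \<open>(b, s, k)\<close> lies in the face \<open>x \<bullet> b = s R\<close> of the cube \<open>[-R, R]\<^sup>d\<close>; \<open>k\<close> is its position in the grid
  that divides every edge into \<open>n\<close> parts.\<close>

definition face_cell :: "real \<Rightarrow> nat \<Rightarrow> 'a::euclidean_space \<times> real \<times> ('a \<Rightarrow> nat) \<Rightarrow> 'a set" where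
  "face_cell R n = (\<lambda>(b, s, k). {x. x \<bullet> b = s * R \<and>
     (\<forall>c\<in>Basis - {b}. real (k c) \<le> (x \<bullet> c + R) * (n / (2 * R)) \<and> (x \<bullet> c + R) * (n / (2 * R)) \<le> real (k c) + 1)})"

definition face_cells :: "nat \<Rightarrow> ('a::euclidean_space \<times> real \<times> ('a \<Rightarrow> nat)) set" where
  "face_cells n = (SIGMA b:Basis. {-1, 1} \<times> (\<Pi>\<^sub>E c\<in>Basis - {b}. {..<n}))"

lemma finite_face_cells: "finite (face_cells n)"
  unfolding face_cells_def by (intro finite_SigmaI finite_cartesian_product finite_PiE) auto

lemma card_face_cells:
  "card (face_cells n :: ('a::euclidean_space \<times> real \<times> ('a \<Rightarrow> nat)) set) = 2 * DIM('a) * n ^ (DIM('a) - 1)"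
proof -
  have "card ({-1, 1::real} \<times> (\<Pi>\<^sub>E c\<in>Basis - {b}. {..<n})) = 2 * n ^ (DIM('a) - 1)" if "b \<in> Basis" for b :: 'a
    using that by (simp add: card_cartesian_product card_PiE)
  then show ?thesis
    unfolding face_cells_def
    by (subst card_SigmaI) (auto intro!: finite_cartesian_product finite_PiE)
qed

lemma frontier_cube_subset_face_cells:
  assumes R: "0 < R" and n: "0 < n"
    and x: "x \<in> frontier (cbox ((- R) *\<^sub>R One) (R *\<^sub>R One))"
  shows "\<exists>j\<in>face_cells n. x \<in> face_cell R n j"
proof -
  have in_cube: "- R \<le> x \<bullet> c \<and> x \<bullet> c \<le> R" if "c \<in> Basis" for c
    using x that by (auto simp: frontier_cbox mem_box)
  obtain b where b: "b \<in> Basis" "x \<bullet> b = - R \<or> x \<bullet> b = R"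
    using x in_cube by (fastforce simp: frontier_cbox mem_box)
  then obtain s where s: "s \<in> {-1, 1}" "x \<bullet> b = s * R"
    by (metis insertCI mult_1 mult_minus1)
  have "\<exists>k<n. real k \<le> (x \<bullet> c + R) * (n / (2 * R)) \<and> (x \<bullet> c + R) * (n / (2 * R)) \<le> real k + 1"
    if "c \<in> Basis" for c
  proof (rule unit_subinterval)
    show "0 \<le> (x \<bullet> c + R) * (n / (2 * R))"
      using in_cube[OF that] R by simp
    have "(x \<bullet> c + R) * (n / (2 * R)) \<le> (2 * R) * (n / (2 * R))"
      using in_cube[OF that] R by (intro mult_right_mono) auto
    then show "(x \<bullet> c + R) * (n / (2 * R)) \<le> real n"
      using R by simp
  qed (rule n)
  then obtain k where k: "\<And>c. c \<in> Basis \<Longrightarrow> k c < n \<and>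
      real (k c) \<le> (x \<bullet> c + R) * (n / (2 * R)) \<and> (x \<bullet> c + R) * (n / (2 * R)) \<le> real (k c) + 1"
    by metis
  have "(b, s, restrict k (Basis - {b})) \<in> face_cells n"
    using b s k by (auto simp: face_cells_def)
  moreover have "x \<in> face_cell R n (b, s, restrict k (Basis - {b}))"
    using s k by (auto simp: face_cell_def)
  ultimately show ?thesis by blast
qed

text \<open>Every coordinate varies by at most one mesh width \<open>2 * R / n\<close>, and the norm
  is bounded by the sum over the coordinates.\<close>

lemma face_cell_dist:
  fixes x y :: "'a::euclidean_space" and R :: real
  assumes R: "0 < R" and n: "0 < n" and x: "x \<in> face_cell R n j" and y: "y \<in> face_cell R n j"
  shows "dist x y \<le> 2 * DIM('a) * R / n"
proof -
  obtain b s k where j: "j = (b, s, k)" by (cases j)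
  have "\<bar>(x - y) \<bullet> c\<bar> \<le> 2 * R / n" if c: "c \<in> Basis" for c
  proof (cases "c = b")
    case True
    with x y R show ?thesis by (simp add: j face_cell_def inner_diff_left)
  next
    case False
    have "\<bar>(x \<bullet> c + R) * (n / (2 * R)) - (y \<bullet> c + R) * (n / (2 * R))\<bar> \<le> 1"
      using x y c False by (auto simp: j face_cell_def abs_le_iff dest!: bspec[of _ _ c])
    also have "(x \<bullet> c + R) * (n / (2 * R)) - (y \<bullet> c + R) * (n / (2 * R)) = ((x - y) \<bullet> c) * (n / (2 * R))"
      by (simp only: inner_diff_left left_diff_distrib distrib_right add_diff_cancel_right)
    finally have "\<bar>((x - y) \<bullet> c) * (n / (2 * R))\<bar> \<le> 1" .
    then have "\<bar>(x - y) \<bullet> c\<bar> * (n / (2 * R)) \<le> 1"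
      using R by (simp add: abs_mult)
    then show ?thesis
      using R n by (simp add: field_simps)
  qed
  then have "(\<Sum>c\<in>Basis. \<bar>(x - y) \<bullet> c\<bar>) \<le> (\<Sum>c\<in>(Basis::'a set). 2 * R / n)"
    by (rule sum_mono)
  then show ?thesis
    using norm_le_l1[of "x - y"] by (simp add: dist_norm mult_ac)
qed

text \<open>The nearest point map onto \<open>K\<close> is a contraction that sends the boundary of a surrounding cube
  onto the boundary of \<open>K\<close>.\<close>

lemma frontier_subset_closest_point_image:
  fixes K :: "'a::euclidean_space set"
  assumes K: "compact K" "convex K" "interior K \<noteq> {}"
    and Q: "bounded Q" "K \<subseteq> interior Q" and x: "x \<in> frontier K"
  shows "\<exists>y\<in>frontier Q. x = closest_point K y"
proof -
  have cl: "closed K"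
    using K(1) by (rule compact_imp_closed)
  have xK: "x \<in> K" "x \<notin> rel_interior K"
    using x cl K(3) by (auto simp: frontier_def rel_interior_nonempty_interior)
  obtain a where a: "a \<noteq> 0" "\<And>y. y \<in> K \<Longrightarrow> a \<bullet> x \<le> a \<bullet> y"
    by (rule supporting_hyperplane_rel_boundary[OF K(2) xK]) (rule that)
  \<comment> \<open>The ray leaves \<open>x\<close> along the outer normal \<open>- a\<close> until
    it meets the boundary of \<open>Q\<close>; \<open>x\<close> is the nearest point of
    \<open>K\<close> for every point on it.\<close>
  obtain t where t: "0 < t" "x + t *\<^sub>R (- a) \<in> frontier Q"
  proof (rule ray_to_frontier[OF Q(1), of x "- a"])
    show "x \<in> interior Q" "- a \<noteq> 0"
      using Q(2) xK(1) a(1) by auto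
  qed (rule that)
  define y where "y = x + t *\<^sub>R (- a)"
  have "dist y x \<le> dist y z" if z: "z \<in> K" for z
  proof -
    have "0 \<le> t * (a \<bullet> (z - x))"
      using t(1) a(2)[OF z] by (simp add: inner_diff_right)
    moreover have "(y - z) \<bullet> (y - z) = (y - x) \<bullet> (y - x) + 2 * (t * (a \<bullet> (z - x))) + (z - x) \<bullet> (z - x)"
    proof -
      have "y - z = t *\<^sub>R (- a) - (z - x)" "y - x = t *\<^sub>R (- a)"
        by (simp_all add: y_def)
      then show ?thesis
        by (simp only: inner_diff_left[of "t *\<^sub>R (- a)"] inner_diff_right[of _ "t *\<^sub>R (- a)"])
          (simp add: inner_commute[of "z - x" a])
    qed
    ultimately show ?thesis
      by (simp add: dist_norm norm_le)
  qed
  then have "x = closest_point K y"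
    by (rule closest_point_unique[OF K(2) cl xK(1) ballI])
  then show ?thesis
    using t(2) unfolding y_def[symmetric] by blast
qed

text \<open>The number of cells grows like the power \<open>DIM('a) - 1\<close> of \<open>n\<close>,
  while the same power of the cell diameter shrinks at the inverse rate, and the nearest point map
  does not enlarge diameters. The bound is therefore uniform in \<open>\<delta>\<close> and survives
  the supremum that defines the Hausdorff measure.\<close>

lemma hausdorff_premeasure_frontier_bounded:
  fixes K :: "'a::euclidean_space set"
  assumes K: "K \<in> convex_bodies"
  shows "\<exists>C. \<forall>\<delta>>0. \<forall>A\<subseteq>frontier K. hausdorff_premeasure (DIM('a) - 1) \<delta> A \<le> ennreal C"
proof -
  have K': "compact K" "convex K" "interior K \<noteq> {}" "closed K" "K \<noteq> {}"
    using K compact_imp_closed by (auto simp: convex_bodies_def)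
  obtain r where r: "\<And>x. x \<in> K \<Longrightarrow> norm x \<le> r"
    using compact_imp_bounded[OF K'(1)] by (auto simp: bounded_iff)
  define R where "R = max r 0 + 1"
  have R: "norm x < R" if "x \<in> K" for x
    using r[OF that] by (auto simp: R_def)
  have R0: "0 < R"
    by (simp add: R_def)
  define Q :: "'a set" where "Q = cbox ((- R) *\<^sub>R One) (R *\<^sub>R One)"
  have KQ: "K \<subseteq> interior Q"
  proof
    fix x assume x: "x \<in> K"
    have "- R < x \<bullet> b \<and> x \<bullet> b < R" if "b \<in> Basis" for b
      using Basis_le_norm[OF that, of x] R[OF x] by (auto simp: abs_le_iff)
    then show "x \<in> interior Q"
      by (simp add: Q_def interior_cbox mem_box)
  qed
  define m where "m = DIM('a) - 1"
  \<comment> \<open>There are \<open>2 * DIM('a) * n ^ m\<close> cells, each contributing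
    \<open>unit_ball_vol m * (DIM('a) * R / n) ^ m\<close>; the powers of \<open>n\<close>
    cancel.\<close>
  define C where "C = 2 * DIM('a) * (unit_ball_vol m * (DIM('a) * R) ^ m)"
  have "hausdorff_premeasure m \<delta> A \<le> ennreal C" if \<delta>: "0 < \<delta>" and A: "A \<subseteq> frontier K" for \<delta> A
  proof -
    \<comment> \<open>The grid is taken so fine that the images of its cells have diameter at most
      \<open>\<delta>\<close>.\<close>
    obtain n :: nat where n: "2 * DIM('a) * R / \<delta> < n"
      using reals_Archimedean2 by blast
    have "0 < 2 * DIM('a) * R / \<delta>"
      using R0 \<delta> by simp
    with n have n0: "0 < n"
      by (metis less_trans of_nat_0_less_iff)
    define \<epsilon> where "\<epsilon> = 2 * DIM('a) * R / n"
    define U where "U j = closest_point K ` face_cell R n j" for j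
    have U: "dist x y \<le> \<epsilon>" if xy: "x \<in> U j" "y \<in> U j" for x y j
    proof -
      obtain v w where vw: "v \<in> face_cell R n j" "w \<in> face_cell R n j"
        "x = closest_point K v" "y = closest_point K w"
        using xy by (auto simp: U_def)
      have "dist x y \<le> dist v w"
        unfolding vw(3,4) by (rule closest_point_lipschitz[OF K'(2,4,5)])
      also have "\<dots> \<le> \<epsilon>"
        unfolding \<epsilon>_def by (rule face_cell_dist[OF R0 n0 vw(1,2)])
      finally show ?thesis .
    qed
    have "hausdorff_premeasure m \<delta> A \<le>
      ennreal (card (face_cells n :: ('a \<times> real \<times> ('a \<Rightarrow> nat)) set) * (unit_ball_vol m * (\<epsilon> / 2) ^ m))"
    proof (rule hausdorff_premeasure_le[OF finite_face_cells])
      show "A \<subseteq> (\<Union>j\<in>face_cells n. U j)"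
      proof
        fix x assume "x \<in> A"
        with A have "x \<in> frontier K" by blast
        moreover have "bounded Q" by (simp add: Q_def)
        ultimately obtain y where y: "y \<in> frontier Q" "x = closest_point K y"
          using frontier_subset_closest_point_image[OF K'(1-3) _ KQ] by blast
        then obtain j where "j \<in> face_cells n" "y \<in> face_cell R n j"
          using frontier_cube_subset_face_cells[OF R0 n0, of y] unfolding Q_def by blast
        with y(2) show "x \<in> (\<Union>j\<in>face_cells n. U j)"
          unfolding U_def by blast
      qed
      show "0 \<le> \<epsilon>" using R0 by (simp add: \<epsilon>_def)
      then show "diameter (U j) \<le> \<epsilon>" for j
        using U by (intro diameter_le) (auto simp: dist_norm)
      show "bounded (U j)" for j
      proof (cases "U j = {}")
        case False
        then obtain x where "x \<in> U j" by blast
        then show ?thesis using U unfolding bounded_def by blast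
      qed simp
      show "\<epsilon> \<le> \<delta>"
        using n \<delta> n0 by (simp add: \<epsilon>_def field_simps)
    qed
    also have "card (face_cells n :: ('a \<times> real \<times> ('a \<Rightarrow> nat)) set) * (unit_ball_vol m * (\<epsilon> / 2) ^ m) = C"
      using n0 unfolding card_face_cells m_def[symmetric]
      by (simp add: C_def \<epsilon>_def power_divide power_mult_distrib)
    finally show ?thesis .
  qed
  then show ?thesis
    unfolding m_def by blast
qed

text \<open>\<open>measure_of\<close> assigns to a set either the value of the given set function or
  0, so upper bounds pass through it unconditionally. The image measure, the restriction and the
  Hausdorff measure are all of this form.\<close>

lemma emeasure_measure_of_le: "emeasure (measure_of \<Omega> \<M> \<mu>) A \<le> \<mu> A"
  by (simp add: emeasure_measure_of_conv)

lemma finite_measure_surface_area_measure: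
  fixes K :: "'a::euclidean_space set"
  assumes K: "K \<in> convex_bodies"
  shows "finite_measure (surface_area_measure K)"
proof
  let ?m = "DIM('a) - 1"
  let ?H = "hausdorff_measure ?m :: 'a measure"
  let ?M = "restrict_space ?H (regular_boundary K)"
  obtain C where C: "\<And>\<delta> A. 0 < \<delta> \<Longrightarrow> A \<subseteq> frontier K \<Longrightarrow> hausdorff_premeasure ?m \<delta> A \<le> ennreal C"
    using hausdorff_premeasure_frontier_bounded[OF K] by blast
  have "emeasure (surface_area_measure K) (space (surface_area_measure K))
      \<le> emeasure ?M (gauss_map K -` space (surface_area_measure K) \<inter> space ?M)" (is "_ \<le> emeasure ?M ?A")
    unfolding surface_area_measure_def distr_def by (rule emeasure_measure_of_le)
  also have "\<dots> \<le> emeasure ?H ?A"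
    unfolding restrict_space_def by (rule emeasure_measure_of_le)
  also have "\<dots> \<le> (SUP \<delta>\<in>{0<..}. hausdorff_premeasure ?m \<delta> ?A)"
    unfolding hausdorff_measure_def by (rule emeasure_measure_of_le)
  also have "\<dots> \<le> ennreal C"
  proof (rule SUP_least)
    have "?A \<subseteq> frontier K"
      by (auto simp: space_restrict_space regular_boundary_def)
    then show "hausdorff_premeasure ?m \<delta> ?A \<le> ennreal C" if "\<delta> \<in> {0<..}" for \<delta>
      using C that by simp
  qed
  finally show "emeasure (surface_area_measure K) (space (surface_area_measure K)) \<noteq> \<infinity>"
    using neq_top_trans[OF ennreal_neq_top] by simp
qed

section \<open>Exactness\<close>

context uniform_sphere
begin

text \<open>The subtracted constant is the integral of the kernel against \<open>\<sigma>\<close>.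
  Against a harmonic of degree \<open>l\<close> the integral is the multiplier of degree
  \<open>l\<close> times the discrete moment, minus that constant times the integral of the
  harmonic. In degree 0 the two cancel because the weights sum to 1; in higher degree either the
  moment or the multiplier is 0.\<close>

lemma exact_kernel_orthogonal:
  assumes \<psi>: "continuous_on {-1..1} \<psi>"
    and x: "\<And>j. j \<in> {1..N} \<Longrightarrow> x j \<in> unit_sphere" and w: "(\<Sum>j=1..N. w j) = 1"
    and exact: "\<And>l p. l \<in> active_spectrum \<sigma> \<psi> \<Longrightarrow> p \<in> homogeneous_harmonic_polys l \<Longrightarrow>
      (\<Sum>j=1..N. w j * p (x j)) = (LINT v|\<sigma>. p v)"
    and q: "real_polynomial_function q"
  shows "(LINT v|\<sigma>. ((\<Sum>j=1..N. w j * \<psi> (x j \<bullet> v)) - funk_hecke_multiplier \<sigma> \<psi> 0) * q v) = 0"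
    (is "(LINT v|\<sigma>. ?g v * q v) = 0")
proof -
  let ?c = "funk_hecke_multiplier \<sigma> \<psi>"
  have cont: "continuous_on unit_sphere ?g"
    using x \<psi> by (intro continuous_intros continuous_on_zonal)
  show ?thesis
  proof (rule polynomial_sphere_induct[OF dim q, where P = "\<lambda>q. (LINT v|\<sigma>. ?g v * q v) = 0"])
    fix l and Y :: "'a \<Rightarrow> real" assume Y: "Y \<in> homogeneous_harmonic_polys l"
    have int: "integrable \<sigma> (\<lambda>v. \<psi> (x j \<bullet> v) * Y v)" if "j \<in> {1..N}" for j
      using Y x[OF that] \<psi>
      by (intro integrable_continuous continuous_on_mult continuous_on_zonal continuous_on_harmonic)
    have intY: "integrable \<sigma> Y"
      using Y by (intro integrable_continuous continuous_on_harmonic)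
    have "(LINT v|\<sigma>. ?g v * Y v)
        = (LINT v|\<sigma>. (\<Sum>j=1..N. w j * (\<psi> (x j \<bullet> v) * Y v)) - ?c 0 * Y v)"
      by (simp add: left_diff_distrib sum_distrib_right mult.assoc)
    also have "\<dots> = (LINT v|\<sigma>. (\<Sum>j=1..N. w j * (\<psi> (x j \<bullet> v) * Y v))) - (LINT v|\<sigma>. ?c 0 * Y v)"
      using int intY by (intro Bochner_Integration.integral_diff Bochner_Integration.integrable_sum) auto
    also have "(LINT v|\<sigma>. (\<Sum>j=1..N. w j * (\<psi> (x j \<bullet> v) * Y v)))
        = (\<Sum>j=1..N. LINT v|\<sigma>. w j * (\<psi> (x j \<bullet> v) * Y v))"
      using int by (intro Bochner_Integration.integral_sum) auto
    also have "\<dots> = (\<Sum>j=1..N. w j * (?c l * Y (x j)))"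
      using funk_hecke[OF \<psi> Y x] by (intro sum.cong) auto
    also have "\<dots> = ?c l * (\<Sum>j=1..N. w j * Y (x j))"
      by (simp add: sum_distrib_left mult.left_commute)
    also have "(LINT v|\<sigma>. ?c 0 * Y v) = ?c 0 * (LINT v|\<sigma>. Y v)"
      by simp
    also have "?c l * (\<Sum>j=1..N. w j * Y (x j)) - ?c 0 * (LINT v|\<sigma>. Y v) = 0"
    proof (cases "l = 0")
      case True
      define y where "y = Y 0"
      have "Y v = y" for v
        unfolding y_def by (rule homogeneous_0D) (use Y True in \<open>simp add: homogeneous_harmonic_polys_iff\<close>)
      then show ?thesis
        using True w by (simp flip: sum_distrib_right)
    next
      case False
      with integral_harmonic[OF Y] have "(LINT v|\<sigma>. Y v) = 0" by simp
      moreover have "?c l * (\<Sum>j=1..N. w j * Y (x j)) = 0"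
      proof (cases "l \<in> active_spectrum \<sigma> \<psi>")
        case True
        with exact[OF True Y] \<open>(LINT v|\<sigma>. Y v) = 0\<close> show ?thesis by simp
      next
        case False
        with \<open>l \<noteq> 0\<close> show ?thesis by (simp add: active_spectrum_def)
      qed
      ultimately show ?thesis by simp
    qed
    finally show "(LINT v|\<sigma>. ?g v * Y v) = 0" .
  next
    fix p q :: "'a \<Rightarrow> real"
    assume pq: "real_polynomial_function p" "real_polynomial_function q"
      "(LINT v|\<sigma>. ?g v * p v) = 0" "(LINT v|\<sigma>. ?g v * q v) = 0"
    have "integrable \<sigma> (\<lambda>v. ?g v * r v)" if "real_polynomial_function r" for r
      by (intro integrable_continuous continuous_on_mult cont real_polynomial_function_continuous_on that)
    then show "(LINT v|\<sigma>. ?g v * (p v + q v)) = 0"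
      using pq by (simp add: distrib_left)
  next
    fix p q :: "'a \<Rightarrow> real"
    assume "\<And>v. v \<in> unit_sphere \<Longrightarrow> p v = q v" "(LINT v|\<sigma>. ?g v * p v) = 0"
    moreover from this(1) have "(LINT v|\<sigma>. ?g v * p v) = (LINT v|\<sigma>. ?g v * q v)"
      by (intro integral_sphere_cong) simp
    ultimately show "(LINT v|\<sigma>. ?g v * q v) = 0"
      by simp
  qed
qed

text \<open>For a polynomial \<open>q\<close> close to \<open>g\<close>, orthogonality turns the
  integral of the square into that of \<open>g * (g - q)\<close>, which is as small as the
  approximation.\<close>

lemma integral_square_eq_0:
  assumes g: "continuous_on unit_sphere g"
    and orth: "\<And>q. real_polynomial_function q \<Longrightarrow> (LINT v|\<sigma>. g v * q v) = 0"
  shows "(LINT v|\<sigma>. g v * g v) = 0"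
proof -
  obtain C where C: "0 \<le> C" "\<And>v. v \<in> unit_sphere \<Longrightarrow> \<bar>g v\<bar> \<le> C"
    using bounded_on_sphere[OF g] by blast
  have "(LINT v|\<sigma>. g v * g v) \<le> 0 + e" if e: "0 < e" for e
  proof -
    define \<delta> where "\<delta> = e / (C + 1)"
    have \<delta>: "0 < \<delta>" using e C(1) by (simp add: \<delta>_def)
    obtain q where q: "real_polynomial_function q" "\<And>v. v \<in> unit_sphere \<Longrightarrow> \<bar>g v - q v\<bar> < \<delta>"
      using Stone_Weierstrass_real_polynomial_function[OF compact_sphere g \<delta>] by blast
    have int: "integrable \<sigma> (\<lambda>v. g v * g v)" "integrable \<sigma> (\<lambda>v. g v * q v)"
      by (intro integrable_continuous continuous_on_mult g
          real_polynomial_function_continuous_on[OF q(1)])+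
    then have "(LINT v|\<sigma>. g v * g v) = (LINT v|\<sigma>. g v * g v - g v * q v)"
      using orth[OF q(1)] by simp
    also have "\<dots> \<le> (LINT v|\<sigma>. C * \<delta>)"
    proof (rule integral_mono)
      fix v assume "v \<in> space \<sigma>"
      then have v: "v \<in> unit_sphere" by (simp add: space_eq)
      have "g v * g v - g v * q v \<le> \<bar>g v\<bar> * \<bar>g v - q v\<bar>"
        by (simp add: right_diff_distrib[symmetric] abs_mult[symmetric])
      also have "\<dots> \<le> C * \<delta>"
        using C(2)[OF v] q(2)[OF v] by (intro mult_mono C(1)) auto
      finally show "g v * g v - g v * q v \<le> C * \<delta>" .
    qed (use int in auto)
    also have "\<dots> \<le> e"
      using C(1) e by (simp add: \<delta>_def field_simps)
    finally show ?thesis by simp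
  qed
  then have "(LINT v|\<sigma>. g v * g v) \<le> 0"
    by (rule field_le_epsilon)
  moreover have "0 \<le> (LINT v|\<sigma>. g v * g v)"
    by simp
  ultimately show ?thesis by simp
qed

text \<open>Continuity on the whole line makes the kernel a composition of Borel maps on the product
  space; on the sphere the inner products stay in \<open>{-1..1}\<close>, where
  \<open>\<psi>\<close> is bounded.\<close>

lemma integrable_kernel:
  assumes \<psi>: "continuous_on UNIV \<psi>" and S: "finite_measure S" "sets S = sets sphere_borel"
  shows "integrable (\<sigma> \<Otimes>\<^sub>M S) (\<lambda>(u, v::'a). \<psi> (u \<bullet> v) :: real)"
proof -
  have "bounded (\<psi> ` {-1..1})"
    using \<psi> by (intro compact_imp_bounded compact_continuous_image continuous_on_subset[OF \<psi>]) auto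
  then obtain B where B: "\<And>t. t \<in> {-1..1} \<Longrightarrow> \<bar>\<psi> t\<bar> \<le> B"
    unfolding bounded_iff real_norm_def by blast
  have spS: "space S = unit_sphere"
    using sets_eq_imp_space_eq[OF S(2)] by (simp add: space_restrict_space)
  have [measurable]: "(\<lambda>v. v) \<in> borel_measurable \<sigma>" "(\<lambda>v. v) \<in> borel_measurable S"
    using measurable_restrict_space1[OF measurable_ident[of "borel :: 'a measure"], of unit_sphere]
      measurable_cong_sets[OF sets_eq refl] measurable_cong_sets[OF S(2) refl] by (auto simp: id_def)
  have [measurable]: "\<psi> \<in> borel_measurable borel"
    using \<psi> by (rule borel_measurable_continuous_onI)
  have fst: "fst \<in> borel_measurable (\<sigma> \<Otimes>\<^sub>M S)" and snd: "snd \<in> borel_measurable (\<sigma> \<Otimes>\<^sub>M S)"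
    using measurable_compose[OF measurable_fst, of "\<lambda>v. v" \<sigma> borel S]
      measurable_compose[OF measurable_snd, of "\<lambda>v. v" S borel \<sigma>] by simp_all
  show ?thesis
  proof (rule finite_measure.integrable_const_bound)
    show "finite_measure (\<sigma> \<Otimes>\<^sub>M S)"
      using S(1) finite_measure_axioms by (rule finite_measure_pair_measure)
    show "AE z in \<sigma> \<Otimes>\<^sub>M S. norm (case z of (u, v) \<Rightarrow> \<psi> (u \<bullet> v)) \<le> B"
    proof (rule AE_I2)
      fix z assume "z \<in> space (\<sigma> \<Otimes>\<^sub>M S)"
      then have "fst z \<in> unit_sphere" "snd z \<in> unit_sphere"
        by (auto simp: space_pair_measure space_eq spS)
      then show "norm (case z of (u, v) \<Rightarrow> \<psi> (u \<bullet> v)) \<le> B"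
        using B[OF inner_in_interval] by (simp add: case_prod_beta')
    qed
    have "(\<lambda>z. \<psi> (fst z \<bullet> snd z)) \<in> borel_measurable (\<sigma> \<Otimes>\<^sub>M S)"
      by (intro measurable_compose[OF borel_measurable_inner[OF fst snd]]) simp
    then show "(\<lambda>(u, v). \<psi> (u \<bullet> v)) \<in> borel_measurable (\<sigma> \<Otimes>\<^sub>M S)"
      by (simp add: case_prod_beta')
  qed
qed

end

lemma B_transform_cong:
  assumes "\<And>t. t \<in> {-1..1} \<Longrightarrow> \<psi> t = \<phi> t" "u \<in> unit_sphere"
  shows "B_transform \<psi> K u = B_transform \<phi> K u"
proof -
  have "space (surface_area_measure K) = unit_sphere"
    by (simp add: surface_area_measure_def space_restrict_space)
  then have "(LINT v|surface_area_measure K. \<psi> (u \<bullet> v)) = (LINT v|surface_area_measure K. \<phi> (u \<bullet> v))"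
    using assms(1)[OF inner_in_interval[OF assms(2)]]
    by (intro Bochner_Integration.integral_cong) (simp_all del: mem_sphere)
  then show ?thesis
    by (simp add: B_transform_def)
qed

context uniform_sphere
begin

text \<open>Both sides equal half the degree 0 multiplier times the total mass of the surface area
  measure: the atomic side by linearity, the other by Fubini.\<close>

lemma universally_exactI:
  assumes \<psi>: "continuous_on {-1..1} \<psi>"
    and x: "\<And>j. j \<in> {1..N} \<Longrightarrow> x j \<in> unit_sphere" and w: "\<And>j. j \<in> {1..N} \<Longrightarrow> 0 \<le> w j"
    and exact: "\<And>v. v \<in> unit_sphere \<Longrightarrow> (\<Sum>j=1..N. w j * \<psi> (x j \<bullet> v)) = funk_hecke_multiplier \<sigma> \<psi> 0"
  shows "universally_exact \<sigma> \<psi> (atomic_measure N w x)"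
  unfolding universally_exact_def
proof
  fix K :: "'a set" assume K: "K \<in> convex_bodies"
  \<comment> \<open>\<open>\<psi>\<close> is constrained only on \<open>{-1..1}\<close>; clamping
    the argument gives an extension that is continuous everywhere, as the product measurability
    asks, and leaves the transform unchanged.\<close>
  define \<phi> where "\<phi> t = \<psi> (max (-1) (min 1 t))" for t
  have \<phi>\<psi>: "\<psi> t = \<phi> t" if "t \<in> {-1..1}" for t
    using that by (simp add: \<phi>_def)
  have \<phi>: "continuous_on UNIV \<phi>"
    unfolding \<phi>_def by (rule continuous_on_compose2[OF \<psi>]) (auto intro!: continuous_intros)
  let ?S = "surface_area_measure K" and ?c = "funk_hecke_multiplier \<sigma> \<psi> 0"
  have setsS: "sets ?S = sets sphere_borel" and spS: "space ?S = unit_sphere"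
    by (simp_all add: surface_area_measure_def space_restrict_space)
  interpret S: finite_measure ?S
    by (rule finite_measure_surface_area_measure[OF K])
  interpret P: pair_sigma_finite \<sigma> ?S ..
  note int = integrable_kernel[OF \<phi> S.finite_measure_axioms setsS]
  have "(LINT u|\<sigma>. B_transform \<psi> K u) = (LINT u|\<sigma>. B_transform \<phi> K u)"
    by (intro integral_sphere_cong B_transform_cong \<phi>\<psi>)
  also have "\<dots> = 1 / 2 * (LINT u|\<sigma>. (LINT v|?S. \<phi> (u \<bullet> v)))"
    unfolding B_transform_def by simp
  also have "(LINT u|\<sigma>. (LINT v|?S. \<phi> (u \<bullet> v))) = (LINT v|?S. (LINT u|\<sigma>. \<phi> (u \<bullet> v)))"
    using P.Fubini_integral[OF int] by simp
  also have "\<dots> = (LINT v|?S. ?c)"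
  proof (rule Bochner_Integration.integral_cong)
    fix v assume "v \<in> space ?S"
    then have v: "v \<in> unit_sphere" by (simp add: spS)
    \<comment> \<open>The constant 1 is a harmonic of degree 0, so Funk--Hecke gives the inner
      integral a value independent of \<open>v\<close>.\<close>
    have one: "(\<lambda>x::'a. 1) \<in> homogeneous_harmonic_polys 0"
      by (auto simp: homogeneous_harmonic_polys_iff homogeneous_def lap_def)
    have "(LINT u|\<sigma>. \<phi> (u \<bullet> v)) = (LINT u|\<sigma>. \<psi> (v \<bullet> u) * 1)"
      using inner_in_interval[OF v] by (intro integral_sphere_cong) (simp add: \<phi>\<psi> inner_commute)
    also have "\<dots> = ?c"
      using funk_hecke[OF \<psi> one v] by simp
    finally show "(LINT u|\<sigma>. \<phi> (u \<bullet> v)) = ?c" .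
  qed simp
  finally have rhs: "(LINT u|\<sigma>. B_transform \<psi> K u) = 1 / 2 * (LINT v|?S. ?c)" .
  have "(\<lambda>u. LINT v|?S. \<phi> (u \<bullet> v)) \<in> borel_measurable \<sigma>"
    using S.borel_measurable_lebesgue_integral[of "\<lambda>u v. \<phi> (u \<bullet> v)" \<sigma>] int by auto
  then have "B_transform \<phi> K \<in> borel_measurable \<sigma>"
    unfolding B_transform_def by simp
  then have "B_transform \<phi> K \<in> borel_measurable sphere_borel"
    using measurable_cong_sets[OF sets_eq refl] by blast
  then have meas: "B_transform \<psi> K \<in> borel_measurable sphere_borel"
    by (subst measurable_cong[of _ _ "B_transform \<phi> K"])
      (auto simp: space_restrict_space intro!: B_transform_cong \<phi>\<psi>)
  have mx: "x \<in> measurable (point_measure {1..N} (\<lambda>j. ennreal (w j))) sphere_borel"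
    using x by (auto simp: space_restrict_space simp del: mem_sphere)
  have "(LINT u|atomic_measure N w x. B_transform \<psi> K u)
      = (LINT j|point_measure {1..N} (\<lambda>j. ennreal (w j)). B_transform \<psi> K (x j))"
    unfolding atomic_measure_def by (rule integral_distr[OF mx meas])
  also have "\<dots> = (\<Sum>j=1..N. w j * B_transform \<psi> K (x j))"
    using w by (subst lebesgue_integral_point_measure_finite) auto
  also have "\<dots> = 1 / 2 * (\<Sum>j=1..N. LINT v|?S. w j * \<psi> (x j \<bullet> v))"
    by (simp add: B_transform_def sum_distrib_left mult.left_commute)
  also have "(\<Sum>j=1..N. LINT v|?S. w j * \<psi> (x j \<bullet> v)) = (LINT v|?S. (\<Sum>j=1..N. w j * \<psi> (x j \<bullet> v)))"
    using x \<psi>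
    by (intro Bochner_Integration.integral_sum[symmetric] integrable_continuous_sphere[OF S.finite_measure_axioms setsS]
        continuous_intros continuous_on_zonal)
  also have "\<dots> = (LINT v|?S. ?c)"
    by (rule Bochner_Integration.integral_cong) (simp_all only: exact spS)
  finally show "(LINT u|atomic_measure N w x. B_transform \<psi> K u) = (LINT u|\<sigma>. B_transform \<psi> K u)"
    using rhs by simp
qed

end

text \<open>\<open>\<sigma>\<close> has full support. If \<open>h v0 > 0\<close>, then
  \<open>h\<close> exceeds some \<open>a > 0\<close> on a cap around \<open>v0\<close>. Finitely
  many caps of that radius cover the sphere, and an orthogonal map takes each centre to
  \<open>v0\<close>; the sum of the correspondingly transported copies of \<open>h\<close> is at
  least \<open>a\<close> everywhere, yet each copy has integral 0.\<close>

lemma uniform_sphere_nonneg_eq_0: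
  fixes \<sigma> :: "(real ^ 'n) measure"
  assumes "uniform_sphere \<sigma>" and h: "continuous_on unit_sphere h"
    and nonneg: "\<And>v. v \<in> unit_sphere \<Longrightarrow> 0 \<le> h v" and int: "(LINT v|\<sigma>. h v) = (0::real)"
    and v0: "v0 \<in> unit_sphere"
  shows "h v0 = 0"
proof (rule ccontr)
  interpret uniform_sphere \<sigma> by fact
  assume "h v0 \<noteq> 0"
  define a where "a = h v0 / 2"
  have a: "0 < a"
    using \<open>h v0 \<noteq> 0\<close> nonneg[OF v0] by (simp add: a_def)
  obtain d where d: "0 < d" "\<And>v. v \<in> unit_sphere \<Longrightarrow> dist v v0 < d \<Longrightarrow> dist (h v) (h v0) < a"
    using h v0 a unfolding continuous_on_iff by meson
  have big: "a < h v" if "v \<in> unit_sphere" "dist v v0 < d" for v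
    using d(2)[OF that] unfolding dist_real_def a_def by linarith
  have "\<exists>f. orthogonal_transformation f \<and> f c = v0" if "c \<in> unit_sphere" for c :: "real ^ 'n"
  proof -
    have "norm c = norm v0"
      using that v0 by simp
    then show ?thesis
      by (metis orthogonal_transformation_exists)
  qed
  then obtain F where F: "\<And>c :: real ^ 'n. c \<in> unit_sphere \<Longrightarrow> orthogonal_transformation (F c) \<and> F c c = v0"
    by metis
  obtain C where C: "finite C" "C \<subseteq> unit_sphere" "(unit_sphere :: (real ^ 'n) set) \<subseteq> (\<Union>c\<in>C. ball c d)"
  proof (rule compactE_image[OF compact_sphere[of "0 :: real ^ 'n" 1], of unit_sphere "\<lambda>x. ball x d"])
    show "(unit_sphere :: (real ^ 'n) set) \<subseteq> (\<Union>x\<in>unit_sphere. ball x d)"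
      using d(1) by force
  qed (use that in auto)
  have Fsphere: "F c v \<in> unit_sphere" if "c \<in> C" "v \<in> unit_sphere" for c v
    using F C(2) that by (auto simp: orthogonal_transformation_norm)
  have cont: "continuous_on unit_sphere (\<lambda>v. h (F c v))" if c: "c \<in> C" for c
  proof (rule continuous_on_compose2[OF h])
    show "continuous_on unit_sphere (F c)"
      using F C(2) c orthogonal_transformation_linear linear_continuous_on linear_conv_bounded_linear by blast
  qed (use Fsphere c in blast)
  have "a = (LINT v|\<sigma>. a)"
    by simp
  also have "\<dots> \<le> (LINT v|\<sigma>. (\<Sum>c\<in>C. h (F c v)))"
  proof (rule integral_mono)
    fix v assume "v \<in> space \<sigma>"
    then have v: "v \<in> unit_sphere" by (simp add: space_eq)
    then obtain c where c: "c \<in> C" "dist c v < d"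
      using C(3) by force
    have Fc: "orthogonal_transformation (F c)" "F c c = v0"
      using F C(2) c(1) by blast+
    then have "dist (F c v) v0 = norm (F c (v - c))"
      by (metis dist_norm linear_diff orthogonal_transformation_linear)
    also have "\<dots> < d"
      using c(2) Fc(1) by (simp add: orthogonal_transformation_norm dist_norm norm_minus_commute)
    finally have "a \<le> h (F c v)"
      using big[OF Fsphere[OF c(1) v]] by (simp add: less_imp_le)
    also have "\<dots> \<le> (\<Sum>c\<in>C. h (F c v))"
      using C(1) c(1) nonneg[OF Fsphere[OF _ v]] by (intro member_le_sum) auto
    finally show "a \<le> (\<Sum>c\<in>C. h (F c v))" .
  qed (use cont in \<open>auto intro!: integrable_continuous continuous_on_sum\<close>)
  also have "\<dots> = (\<Sum>c\<in>C. LINT v|\<sigma>. h (F c v))"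
    using cont by (intro Bochner_Integration.integral_sum integrable_continuous)
  also have "\<dots> = 0"
  proof (rule sum.neutral, rule ballI)
    fix c assume "c \<in> C"
    then have "orthogonal_transformation (F c)"
      using F C(2) by blast
    then show "(LINT v|\<sigma>. h (F c v)) = 0"
      using integral_orthogonal[OF _ h] int by simp
  qed
  finally show False using a by simp
qed

theorem corollary3p8:
  fixes \<psi> :: "real \<Rightarrow> real" and \<sigma> :: "(real ^ 'n) measure"
  assumes "CARD('n) \<ge> 2"
    and "uniform_on_sphere \<sigma>"
    and "continuous_on {-1..1} \<psi>"
    and "\<forall>t\<in>{-1..1}. \<psi> (- t) = \<psi> t"
    and "finite (active_spectrum \<sigma> \<psi>)"
  shows "\<exists>(N::nat) (w :: nat \<Rightarrow> real) (x :: nat \<Rightarrow> real ^ 'n).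
           (\<forall>j\<in>{1..N}. x j \<in> sphere 0 1 \<and> 0 < w j) \<and>
           (\<Sum>j=1..N. w j) = 1 \<and>
           universally_exact \<sigma> \<psi> (atomic_measure N w x) \<and>
           N \<le> (\<Sum>l\<in>active_spectrum \<sigma> \<psi>. harmonic_dim CARD('n) l) + 1"
proof -
  have dim: "2 \<le> DIM(real ^ 'n)"
    using assms(1) by simp
  interpret uniform_sphere \<sigma>
    by standard (fact assms(2) dim)+
  let ?A = "active_spectrum \<sigma> \<psi>" and ?d = "harmonic_dim CARD('n)"
  have "\<exists>h :: nat \<Rightarrow> real ^ 'n \<Rightarrow> real. (\<forall>i<?d l. h i \<in> homogeneous_harmonic_polys l) \<and>
    (\<forall>p\<in>homogeneous_harmonic_polys l. \<exists>c. p = (\<lambda>x. \<Sum>i<?d l. c i * h i x))" for l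
    using homogeneous_harmonic_polys_spanning_family[OF dim, of l] by simp
  then obtain h :: "nat \<Rightarrow> nat \<Rightarrow> real ^ 'n \<Rightarrow> real"
    where h: "\<And>l i. i < ?d l \<Longrightarrow> h l i \<in> homogeneous_harmonic_polys l"
      "\<And>l p. p \<in> homogeneous_harmonic_polys l \<Longrightarrow> \<exists>c. p = (\<lambda>x. \<Sum>i<?d l. c i * h l i x)"
    by metis
  \<comment> \<open>One moment for each active degree and each member of its spanning family; the
    cardinality is the sum of the dimensions in the bound.\<close>
  define I where "I = (SIGMA l:?A. {..<?d l})"
  have I: "finite I" "card I = (\<Sum>l\<in>?A. ?d l)"
    using assms(5) by (auto simp: I_def card_SigmaI)
  have "continuous_on unit_sphere (case i of (l, k) \<Rightarrow> h l k)" if "i \<in> I" for i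
    using that h(1) continuous_on_harmonic by (auto simp: I_def)
  from tchakaloff[of I "\<lambda>(l, k). h l k", OF I(1) this]
  obtain N w x where Nwx: "\<And>j. j \<in> {1..N} \<Longrightarrow> x j \<in> unit_sphere" "\<And>j. j \<in> {1..N} \<Longrightarrow> 0 < w j"
    "(\<Sum>j=1..N. w j) = 1"
    "\<And>i. i \<in> I \<Longrightarrow> (\<Sum>j=1..N. w j * (case i of (l, k) \<Rightarrow> h l k) (x j)) = (LINT v|\<sigma>. (case i of (l, k) \<Rightarrow> h l k) v)"
    "N \<le> card I + 1"
    by blast
  \<comment> \<open>By linearity, exactness passes from the spanning families to all harmonics of
    active degree.\<close>
  have exact: "(\<Sum>j=1..N. w j * p (x j)) = (LINT v|\<sigma>. p v)"
    if l: "l \<in> ?A" and p: "p \<in> homogeneous_harmonic_polys l" for l p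
  proof -
    obtain c where c: "p = (\<lambda>x. \<Sum>i<?d l. c i * h l i x)"
      using h(2)[OF p] by blast
    have "(\<Sum>j=1..N. w j * p (x j)) = (\<Sum>i<?d l. c i * (\<Sum>j=1..N. w j * h l i (x j)))"
      unfolding c sum_distrib_left by (subst sum.swap) (simp add: mult.left_commute)
    also have "\<dots> = (\<Sum>i<?d l. c i * (LINT v|\<sigma>. h l i v))"
      using Nwx(4)[of "(l, _)"] l by (intro sum.cong) (auto simp: I_def)
    also have "\<dots> = (\<Sum>i<?d l. LINT v|\<sigma>. c i * h l i v)"
      by simp
    also have "\<dots> = (LINT v|\<sigma>. p v)"
      unfolding c using h(1)[of _ l]
      by (intro Bochner_Integration.integral_sum[symmetric] integrable_mult_right integrable_continuous
          continuous_on_harmonic) auto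
    finally show ?thesis .
  qed
  define g where "g v = (\<Sum>j=1..N. w j * \<psi> (x j \<bullet> v)) - funk_hecke_multiplier \<sigma> \<psi> 0" for v
  have g: "continuous_on unit_sphere g"
    unfolding g_def using Nwx(1) assms(3) by (intro continuous_intros continuous_on_zonal)
  have "(LINT v|\<sigma>. g v * q v) = 0" if "real_polynomial_function q" for q
    unfolding g_def by (rule exact_kernel_orthogonal[OF assms(3) Nwx(1,3) exact that])
  then have int: "(LINT v|\<sigma>. g v * g v) = 0"
    by (rule integral_square_eq_0[OF g])
  \<comment> \<open>The pointwise statement is what lets \<open>g\<close> be integrated against
    surface area measures that are singular with respect to \<open>\<sigma>\<close>.\<close>
  have "g v * g v = 0" if "v \<in> unit_sphere" for v
    by (rule uniform_sphere_nonneg_eq_0[where h = "\<lambda>v. g v * g v",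
          OF uniform_sphere_axioms continuous_on_mult[OF g g] zero_le_square int that])
  then have "(\<Sum>j=1..N. w j * \<psi> (x j \<bullet> v)) = funk_hecke_multiplier \<sigma> \<psi> 0" if "v \<in> unit_sphere" for v
    using that by (simp add: g_def)
  then have "universally_exact \<sigma> \<psi> (atomic_measure N w x)"
    using Nwx(2) by (intro universally_exactI[OF assms(3) Nwx(1)] less_imp_le) blast+
  with Nwx I(2) show ?thesis
    by (intro exI[of _ N] exI[of _ w] exI[of _ x] conjI ballI) simp_all
qed

end
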